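(* Let $\mathcal{L}$ be a second-order linear operator on $\mathbb{R}^N$ satisfying assumptions (H1), (H2), (H3), (FS), (G), (L) stated in the context. Let $F\subseteq\mathbb{R}^N$ be any non-empty set. If there exists some $p\in(1,\infty)$ such that $F$ is $p_{\mathcal{L}}$-unbounded, then $F$ is $\mathcal{L}$-large at infinity.
   Context: Operator: $\mathcal{L}=\frac{1}{V(x)}\sum_{i=1}^N\frac{\partial}{\partial x_i}\Big(\sum_{j=1}^N V(x)a_{i,j}(x)\frac{\partial}{\partial x_j}\Big)$ on $\mathbb{R}^N$, where: (H1) $V,a_{i,j}\in C^\infty(\mathbb{R}^N,\mathbb{R})$ for all $i,j$ and $V>0$ on $\mathbb{R}^N$; (H2) the matrix $A(x)=(a_{i,j}(x))_{i,j}$ is symmetric, positive semi-definite and $\mathrm{trace}(A(x))>0$ for every $x\in\mathbb{R}^N$; (H3) there is $\varepsilon>0$ such that both $\mathcal{L}$ and $\mathcal{L}-\varepsilon$ are $C^\infty$-hypoelliptic in every open subset of $\mathbb{R}^N$ (an operator $P$ is $C^\infty$-hypoelliptic in $\Omega$ if every distributional solution $u$ of $Pu=f$ is smooth in $\Omega$ whenever $f$ is smooth). (FS) There is a function $\Gamma:\{(x,y)\in\mathbb{R}^N\times\mathbb{R}^N:x\ne y\}\to\mathbb{R}$ which is $C^\infty$, strictly positive and symmetric, such that for every $x\in\mathbb{R}^N$: $\Gamma(x,\cdot)\in L^1_{\mathrm{loc}}(\mathbb{R}^N)$ and $\int_{\mathbb{R}^N}\Gamma(x,y)\,\mathcal{L}\varphi(y)\,V(y)\,dy=-\varphi(x)$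 for all $\varphi\in C_0^\infty(\mathbb{R}^N,\mathbb{R})$; $\lim_{y\to x}\Gamma(x,y)=\infty$; $\lim_{\|y\|\to\infty}\Gamma(x,y)=0$. Set $\gamma(x,y)=1/\Gamma(x,y)$ for $x\neq y$, $\gamma(x,x)=0$, and define the $\Gamma$-ball $\Omega(x,r)=\{y\in\mathbb{R}^N:\gamma(x,y)<r\}$ for $x\in\mathbb{R}^N$, $r>0$. (G) There is $\theta\in(0,1)$ such that $x\notin\Omega(y,r)$ implies $\Omega(x,\theta r)\cap\Omega(y,\theta r)=\varnothing$, for all $x,y\in\mathbb{R}^N$, $r>0$. (L) Every $\mathcal{L}$-harmonic function on $\mathbb{R}^N$ which is bounded from above (or from below) is constant. Potential theory: a function is $\mathcal{L}$-harmonic in an open set if it is a smooth solution of $\mathcal{L}u=0$ there. For $\Omega\subseteq\mathbb{R}^N$ open, an upper semicontinuous function $u:\Omega\to[-\infty,\infty)$ is $\mathcal{L}$-subharmonic in $\Omega$ if (i) $\{x\in\Omega:u(x)>-\infty\}$ is dense in $\Omega$; (ii) for every bounded open set $W$ with $\overline W\subseteq\Omega$ and every $h$ that is $\mathcal{L}$-harmonic in $W$, continuous up to $\partial W$ and satisfies $u\le h$ on $\partial W$, one has $u\le h$ in $W$. $\underline{\mathcal{L}}_b(\Omega)$ denotes the set of $\mathcal{L}$-subharmonic functions in $\Omega$ that are bounded above. $p_{\mathcal{L}}$-boundedness: for $p\in(1,\infty)$, $F\subseteq\mathbb{R}^N$ is $p_{\mathcal{L}}$-bounded if there is a countable family $\{\Omega(x_n,r_n)\}_{n\in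 J}$ of $\Gamma$-balls such that $F\subseteq\bigcup_{n\in J}\Omega(x_n,r_n)$ and $\sum_{n\in J}\big(r_n/\gamma(0,x_n)\big)^p<\infty$ (a term with $x_n=0$ counts as $+\infty$). $F$ is $p_{\mathcal{L}}$-unbounded if it is not $p_{\mathcal{L}}$-bounded. Thin/large sets: an unbounded set $F\subseteq\mathbb{R}^N$ is $\mathcal{L}$-thin at infinity if there is $u\in\underline{\mathcal{L}}_b(\mathbb{R}^N)$ with $\limsup_{x\to\infty,\,x\in F}u(x)<\limsup_{x\to\infty}u(x)$. A bounded set $F$ is $\mathcal{L}$-thin at infinity if there is $u\in\underline{\mathcal{L}}_b(\mathbb{R}^N)$ with $\sup_F u<\sup_{\mathbb{R}^N}u$. $F$ is $\mathcal{L}$-large at infinity if it is not $\mathcal{L}$-thin at infinity. *)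

theory Defs
  imports "HOL-Analysis.Analysis"
begin

section \<open>Smooth functions and test functions\<close>

definition partial :: "'a::euclidean_space \<Rightarrow> ('a \<Rightarrow> real) \<Rightarrow> 'a \<Rightarrow> real" where
  "partial b f x = frechet_derivative f (at x) b"

fun iter_partial :: "'a::euclidean_space list \<Rightarrow> ('a \<Rightarrow> real) \<Rightarrow> 'a \<Rightarrow> real" where
  "iter_partial [] f = f"
| "iter_partial (b # bs) f = partial b (iter_partial bs f)"

text \<open>Meant for open \<open>S\<close>. All iterated partial derivatives are required to be
  differentiable; in particular they are all continuous, so this is \<open>C\<^sup>\<infinity>(S)\<close>.\<close>

definition smooth_on :: "'a::euclidean_space set \<Rightarrow> ('a \<Rightarrow> real) \<Rightarrow> bool" where
  "smooth_on S f \<longleftrightarrow>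
     (\<forall>bs. set bs \<subseteq> Basis \<longrightarrow> (\<forall>x\<in>S. iter_partial bs f differentiable (at x)))"

definition supp :: "('a::euclidean_space \<Rightarrow> real) \<Rightarrow> 'a set" where
  "supp f = closure {x. f x \<noteq> 0}"

definition test_functions :: "'a::euclidean_space set \<Rightarrow> ('a \<Rightarrow> real) set" where
  "test_functions \<Omega> = {\<phi>. smooth_on UNIV \<phi> \<and> compact (supp \<phi>) \<and> supp \<phi> \<subseteq> \<Omega>}"

section \<open>Distributions\<close>

text \<open>A distribution on \<open>\<Omega>\<close> is a linear functional on the test functions of \<open>\<Omega>\<close> which, on each
  compact set, is bounded by finitely many of the sup-norms of derivatives. It is represented by
  a total functional whose values outside \<open>test_functions \<Omega>\<close> are irrelevant.\<close>

definition distribution_on ::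
  "'a::euclidean_space set \<Rightarrow> (('a \<Rightarrow> real) \<Rightarrow> real) \<Rightarrow> bool" where
  "distribution_on \<Omega> T \<longleftrightarrow>
     (\<forall>\<phi>\<in>test_functions \<Omega>. \<forall>\<psi>\<in>test_functions \<Omega>. T (\<lambda>x. \<phi> x + \<psi> x) = T \<phi> + T \<psi>) \<and>
     (\<forall>c. \<forall>\<phi>\<in>test_functions \<Omega>. T (\<lambda>x. c * \<phi> x) = c * T \<phi>) \<and>
     (\<forall>K. compact K \<and> K \<subseteq> \<Omega> \<longrightarrow>
        (\<exists>C m. \<forall>\<phi>\<in>test_functions \<Omega>. supp \<phi> \<subseteq> K \<longrightarrow>
           \<bar>T \<phi>\<bar> \<le> C * (\<Sum>bs\<in>{bs. set bs \<subseteq> Basis \<and> length bs \<le> m}.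
                         SUP x. \<bar>iter_partial bs \<phi> x\<bar>)))"

definition dist_of_fun :: "('a::euclidean_space \<Rightarrow> real) \<Rightarrow> ('a \<Rightarrow> real) \<Rightarrow> real" where
  "dist_of_fun f \<phi> = (LINT x|lborel. f x * \<phi> x)"

definition dist_mult ::
  "('a \<Rightarrow> real) \<Rightarrow> (('a \<Rightarrow> real) \<Rightarrow> real) \<Rightarrow> ('a::euclidean_space \<Rightarrow> real) \<Rightarrow> real" where
  "dist_mult g T \<phi> = T (\<lambda>x. g x * \<phi> x)"

definition dist_partial ::
  "'a \<Rightarrow> (('a \<Rightarrow> real) \<Rightarrow> real) \<Rightarrow> ('a::euclidean_space \<Rightarrow> real) \<Rightarrow> real" where
  "dist_partial b T \<phi> = - T (partial b \<phi>)"

definition hypoelliptic_in ::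
  "'a::euclidean_space set \<Rightarrow> ((('a \<Rightarrow> real) \<Rightarrow> real) \<Rightarrow> (('a \<Rightarrow> real) \<Rightarrow> real)) \<Rightarrow> bool" where
  "hypoelliptic_in \<Omega> P \<longleftrightarrow>
     (\<forall>T f. distribution_on \<Omega> T \<and> smooth_on \<Omega> f \<and>
        (\<forall>\<phi>\<in>test_functions \<Omega>. P T \<phi> = dist_of_fun f \<phi>) \<longrightarrow>
        (\<exists>g. smooth_on \<Omega> g \<and> (\<forall>\<phi>\<in>test_functions \<Omega>. T \<phi> = dist_of_fun g \<phi>)))"

section \<open>The operator\<close>

definition L_op ::
  "(real^'n \<Rightarrow> real) \<Rightarrow> (real^'n \<Rightarrow> real^'n^'n) \<Rightarrow> (real^'n \<Rightarrow> real) \<Rightarrow> real^'n::finite \<Rightarrow> real" where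
  "L_op V A u x = 1 / V x * (\<Sum>i\<in>UNIV. partial (axis i 1)
     (\<lambda>y. \<Sum>j\<in>UNIV. V y * A y $ i $ j * partial (axis j 1) u y) x)"

text \<open>The same operator acting on distributions, composed of distributional derivatives and
  multiplications by smooth functions.\<close>

definition L_dist ::
  "(real^'n \<Rightarrow> real) \<Rightarrow> (real^'n \<Rightarrow> real^'n^'n) \<Rightarrow> ((real^'n \<Rightarrow> real) \<Rightarrow> real) \<Rightarrow>
     (real^'n::finite \<Rightarrow> real) \<Rightarrow> real" where
  "L_dist V A T = dist_mult (\<lambda>x. 1 / V x) (\<lambda>\<phi>. \<Sum>i\<in>UNIV. dist_partial (axis i 1)
     (\<lambda>\<psi>. \<Sum>j\<in>UNIV. dist_mult (\<lambda>x. V x * A x $ i $ j) (dist_partial (axis j 1) T) \<psi>) \<phi>)"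

definition H1 :: "(real^'n \<Rightarrow> real) \<Rightarrow> (real^'n::finite \<Rightarrow> real^'n^'n) \<Rightarrow> bool" where
  "H1 V A \<longleftrightarrow> smooth_on UNIV V \<and> (\<forall>i j. smooth_on UNIV (\<lambda>x. A x $ i $ j)) \<and> (\<forall>x. 0 < V x)"

definition H2 :: "(real^'n::finite \<Rightarrow> real^'n^'n) \<Rightarrow> bool" where
  "H2 A \<longleftrightarrow> (\<forall>x. transpose (A x) = A x \<and> (\<forall>\<xi>. 0 \<le> \<xi> \<bullet> (A x *v \<xi>)) \<and> 0 < trace (A x))"

definition H3 :: "(real^'n \<Rightarrow> real) \<Rightarrow> (real^'n::finite \<Rightarrow> real^'n^'n) \<Rightarrow> bool" where
  "H3 V A \<longleftrightarrow> (\<exists>\<epsilon>>0. \<forall>\<Omega>. open \<Omega> \<longrightarrow>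
     hypoelliptic_in \<Omega> (L_dist V A) \<and>
     hypoelliptic_in \<Omega> (\<lambda>T \<phi>. L_dist V A T \<phi> - \<epsilon> * T \<phi>))"

section \<open>Fundamental solution and its balls\<close>

text \<open>The value \<open>\<Gamma> x x\<close> is never constrained nor used.\<close>

definition FS ::
  "(real^'n \<Rightarrow> real) \<Rightarrow> (real^'n \<Rightarrow> real^'n^'n) \<Rightarrow> (real^'n \<Rightarrow> real^'n::finite \<Rightarrow> real) \<Rightarrow> bool" where
  "FS V A \<Gamma> \<longleftrightarrow>
     smooth_on {(x, y). x \<noteq> y} (\<lambda>(x, y). \<Gamma> x y) \<and>
     (\<forall>x y. x \<noteq> y \<longrightarrow> 0 < \<Gamma> x y \<and> \<Gamma> x y = \<Gamma> y x) \<and>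
     (\<forall>x. (\<forall>K. compact K \<longrightarrow> set_integrable lborel K (\<Gamma> x)) \<and>
          (\<forall>\<phi>\<in>test_functions UNIV.
             (LINT y|lborel. \<Gamma> x y * L_op V A \<phi> y * V y) = - \<phi> x) \<and>
          filterlim (\<Gamma> x) at_top (at x) \<and>
          (\<Gamma> x \<longlongrightarrow> 0) at_infinity)"

definition gam :: "('a \<Rightarrow> 'a \<Rightarrow> real) \<Rightarrow> 'a \<Rightarrow> 'a \<Rightarrow> real" where
  "gam \<Gamma> x y = (if x = y then 0 else 1 / \<Gamma> x y)"

definition Gamma_ball :: "('a \<Rightarrow> 'a \<Rightarrow> real) \<Rightarrow> 'a \<Rightarrow> real \<Rightarrow> 'a set" where
  "Gamma_ball \<Gamma> x r = {y. gam \<Gamma> x y < r}"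

definition G_cond :: "('a \<Rightarrow> 'a \<Rightarrow> real) \<Rightarrow> bool" where
  "G_cond \<Gamma> \<longleftrightarrow> (\<exists>\<theta>\<in>{0<..<1}. \<forall>x y. \<forall>r>0.
     x \<notin> Gamma_ball \<Gamma> y r \<longrightarrow> Gamma_ball \<Gamma> x (\<theta> * r) \<inter> Gamma_ball \<Gamma> y (\<theta> * r) = {})"

section \<open>Potential theory\<close>

definition L_harmonic ::
  "(real^'n \<Rightarrow> real) \<Rightarrow> (real^'n \<Rightarrow> real^'n^'n) \<Rightarrow> (real^'n) set \<Rightarrow>
     (real^'n::finite \<Rightarrow> real) \<Rightarrow> bool" where
  "L_harmonic V A \<Omega> u \<longleftrightarrow> smooth_on \<Omega> u \<and> (\<forall>x\<in>\<Omega>. L_op V A u x = 0)"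

definition L_cond :: "(real^'n \<Rightarrow> real) \<Rightarrow> (real^'n::finite \<Rightarrow> real^'n^'n) \<Rightarrow> bool" where
  "L_cond V A \<longleftrightarrow> (\<forall>u. L_harmonic V A UNIV u \<and> (bdd_above (range u) \<or> bdd_below (range u)) \<longrightarrow>
     u constant_on UNIV)"

definition usc_on :: "'a::topological_space set \<Rightarrow> ('a \<Rightarrow> ereal) \<Rightarrow> bool" where
  "usc_on \<Omega> u \<longleftrightarrow> (\<forall>t. openin (top_of_set \<Omega>) {x\<in>\<Omega>. u x < t})"

definition L_subharmonic ::
  "(real^'n \<Rightarrow> real) \<Rightarrow> (real^'n \<Rightarrow> real^'n^'n) \<Rightarrow> (real^'n) set \<Rightarrow>
     (real^'n::finite \<Rightarrow> ereal) \<Rightarrow> bool" where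
  "L_subharmonic V A \<Omega> u \<longleftrightarrow>
     (\<forall>x\<in>\<Omega>. u x < \<infinity>) \<and> usc_on \<Omega> u \<and>
     \<Omega> \<subseteq> closure {x\<in>\<Omega>. u x > -\<infinity>} \<and>
     (\<forall>W h. open W \<and> bounded W \<and> closure W \<subseteq> \<Omega> \<and>
        L_harmonic V A W h \<and> continuous_on (closure W) h \<and>
        (\<forall>x\<in>frontier W. u x \<le> ereal (h x)) \<longrightarrow> (\<forall>x\<in>W. u x \<le> ereal (h x)))"

definition L_subharmonic_b ::
  "(real^'n \<Rightarrow> real) \<Rightarrow> (real^'n \<Rightarrow> real^'n^'n) \<Rightarrow> (real^'n) set \<Rightarrow>
     (real^'n::finite \<Rightarrow> ereal) set" where
  "L_subharmonic_b V A \<Omega> =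
     {u. L_subharmonic V A \<Omega> u \<and> (\<exists>M::real. \<forall>x\<in>\<Omega>. u x \<le> ereal M)}"

definition thin_at_infinity ::
  "(real^'n \<Rightarrow> real) \<Rightarrow> (real^'n \<Rightarrow> real^'n^'n) \<Rightarrow> (real^'n::finite) set \<Rightarrow> bool" where
  "thin_at_infinity V A F \<longleftrightarrow>
     (if bounded F
      then \<exists>u\<in>L_subharmonic_b V A UNIV. (SUP x\<in>F. u x) < (SUP x. u x)
      else \<exists>u\<in>L_subharmonic_b V A UNIV.
             Limsup (inf at_infinity (principal F)) u < Limsup at_infinity u)"

definition large_at_infinity ::
  "(real^'n \<Rightarrow> real) \<Rightarrow> (real^'n \<Rightarrow> real^'n^'n) \<Rightarrow> (real^'n::finite) set \<Rightarrow> bool" where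
  "large_at_infinity V A F \<longleftrightarrow> \<not> thin_at_infinity V A F"

section \<open>\<open>p\<close>-boundedness\<close>

text \<open>The countable index set is taken as an arbitrary subset of the naturals; the sum is
  formed in \<open>[0,\<infinity>]\<close>, where it always exists.\<close>

definition p_bounded ::
  "('a::zero \<Rightarrow> 'a \<Rightarrow> real) \<Rightarrow> real \<Rightarrow> 'a set \<Rightarrow> bool" where
  "p_bounded \<Gamma> p F \<longleftrightarrow> (\<exists>(J::nat set) x r.
     (\<forall>n\<in>J. 0 < r n) \<and> F \<subseteq> (\<Union>n\<in>J. Gamma_ball \<Gamma> (x n) (r n)) \<and>
     infsum (\<lambda>n. if x n = 0 then \<infinity> else ennreal ((r n / gam \<Gamma> 0 (x n)) powr p)) J < \<infinity>)"

definition p_unbounded ::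
  "('a::zero \<Rightarrow> 'a \<Rightarrow> real) \<Rightarrow> real \<Rightarrow> 'a set \<Rightarrow> bool" where
  "p_unbounded \<Gamma> p F \<longleftrightarrow> \<not> p_bounded \<Gamma> p F"

end

theory Submission
  imports Defs "HOL-Computational_Algebra.Polynomial"
begin

text \<open>Let \<open>u\<close> be subharmonic with supremum \<open>S\<close> and let \<open>a < S\<close> bound \<open>u\<close> on \<open>F\<close> near infinity. If
  a finite positive combination \<open>P\<close> of functions \<open>\<Gamma>(y\<^sub>i, \<cdot>)\<close> satisfies \<open>P \<le> C\<close> outside small
  balls around the \<open>y\<^sub>i\<close> contained in the open set \<open>{u < a}\<close>, then comparison with harmonic functions
  gives \<open>u \<le> S - (S - a) P / C\<close> outside these balls. At a point \<open>x\<^sub>0\<close> where \<open>u\<close> is very close to \<open>S\<close>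
  this forces \<open>P(x\<^sub>0)\<close> to be small compared with \<open>C\<close>; no Riesz decomposition is needed.

  Apply this to a Frostman-type choice of masses on a countable family of centres whose balls cover
  \<open>{u < a}\<close>: running through the centres, each one receives the largest mass for which the balls
  \<open>B\<close> of radius \<open>t\<close> around it have mass at most \<open>R (t/R)\<^sup>p\<close>, where \<open>R = \<gamma>(0, y\<^sub>i)\<close>. As \<open>p > 1\<close>, this growth
  condition bounds the potential, so \<open>\<Sum>m\<^sub>i/R\<^sub>i\<close> is finite; and every centre has a ball on
  which the constraint is half saturated, so that a Vitali selection of these balls is a cover with
  \<open>\<Sum>(r/R)\<^sup>p < \<infinity>\<close>.\<close>

section \<open>Greedy masses and Vitali covers in quasi-ultrametric spaces\<close>

text \<open>Zorn's lemma applies to the disjoint families which, to every set they meet, offer a met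
  member of at least half its size. A maximal such family meets every set: otherwise a nearly
  largest one among the sets it misses could be added. \<open>D\<close> and \<open>s\<close> are
  unrelated, so any bounded positive numbers may serve as sizes.\<close>

lemma Vitali_finite_overlap:
  fixes D :: "'i \<Rightarrow> 'b set" and s :: "'i \<Rightarrow> real"
  assumes pos: "\<And>i. 0 < s i" and bdd: "\<And>i. s i \<le> M" and ne: "\<And>i. D i \<noteq> {}"
  shows "\<exists>S. disjoint_family_on D S \<and> (\<forall>i. \<exists>j\<in>S. D i \<inter> D j \<noteq> {} \<and> s i \<le> 2 * s j)"
proof -
  define good where "good S \<longleftrightarrow> disjoint_family_on D S \<and>
    (\<forall>i. (\<exists>j\<in>S. D i \<inter> D j \<noteq> {}) \<longrightarrow> (\<exists>j\<in>S. D i \<inter> D j \<noteq> {} \<and> s i \<le> 2 * s j))" for S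
  have "\<exists>S\<in>{S. good S}. \<forall>X\<in>{S. good S}. S \<subseteq> X \<longrightarrow> X = S"
  proof (rule subset_Zorn')
    fix C assume C: "subset.chain {S. good S} C"
    have good: "good S" if "S \<in> C" for S
      using C that by (auto simp: subset.chain_def)
    have "disjoint_family_on D (\<Union>C)"
      unfolding disjoint_family_on_def
    proof (intro ballI impI)
      fix i j assume ij: "i \<in> \<Union>C" "j \<in> \<Union>C" "i \<noteq> j"
      then obtain S where "S \<in> C" "i \<in> S" "j \<in> S"
        using C unfolding subset_chain_def by blast
      then show "D i \<inter> D j = {}"
        using good[of S] ij by (auto simp: good_def disjoint_family_on_def)
    qed
    then show "\<Union>C \<in> {S. good S}"
      using good unfolding good_def by blast
  qed
  then obtain S where S: "good S" and max: "\<And>X. good X \<Longrightarrow> S \<subseteq> X \<Longrightarrow> X = S" by blast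
  have "\<exists>j\<in>S. D i \<inter> D j \<noteq> {}" for i
  proof (rule ccontr)
    assume none: "\<not> (\<exists>j\<in>S. D i \<inter> D j \<noteq> {})"
    define U where "U = {i. \<forall>j\<in>S. D i \<inter> D j = {}}"
    have "i \<in> U" using none by (auto simp: U_def)
    have bddU: "bdd_above (s ` U)" using bdd by (auto intro!: bdd_aboveI2)
    have "s i \<le> Sup (s ` U)" using \<open>i \<in> U\<close> bddU by (intro cSUP_upper)
    then have "Sup (s ` U) / 2 < Sup (s ` U)" using pos[of i] by simp
    then obtain j where j: "j \<in> U" "Sup (s ` U) / 2 < s j"
      using less_cSup_iff[of "s ` U" "Sup (s ` U) / 2"] \<open>i \<in> U\<close> bddU by auto
    have large: "s k \<le> 2 * s j" if "k \<in> U" for k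
      using cSUP_upper[OF that bddU] j by simp
    have "disjoint_family_on D (insert j S)"
      using S j(1) by (auto simp: good_def disjoint_family_on_def U_def)
    \<comment> \<open>A set met for the first time lies in \<open>U\<close>, so \<open>j\<close>
      itself serves; any other set keeps the partner it had in \<open>S\<close>.\<close>
    moreover have "\<exists>l\<in>insert j S. D k \<inter> D l \<noteq> {} \<and> s k \<le> 2 * s l"
      if "\<exists>l\<in>insert j S. D k \<inter> D l \<noteq> {}" for k
    proof (cases "k \<in> U")
      case True
      then show ?thesis using that large[of k] by (auto simp: U_def)
    next
      case False
      then show ?thesis using S by (auto simp: good_def U_def)
    qed
    ultimately have "good (insert j S)" unfolding good_def by blast
    then have "j \<in> S" using max by blast
    then show False using j(1) ne[of j] by (auto simp: U_def)
  qed
  then have "\<forall>i. \<exists>j\<in>S. D i \<inter> D j \<noteq> {} \<and> s i \<le> 2 * s j"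
    using S unfolding good_def by blast
  then show ?thesis using S unfolding good_def by blast
qed

text \<open>Split the ball into dyadic shells: where \<open>\<delta>\<close> is comparable to
  \<open>s\<close>, the growth bound gives a contribution of order \<open>s powr (p - 1)\<close>,
  and these contributions form a geometric series because \<open>p > 1\<close>.\<close>

lemma sum_div_le_of_growth:
  fixes w \<delta> :: "'i \<Rightarrow> real"
  assumes fin: "finite N" and nn: "\<And>i. i \<in> N \<Longrightarrow> 0 \<le> w i" "\<And>i. i \<in> N \<Longrightarrow> 0 < \<delta> i"
    and p: "1 < p" and B: "0 \<le> B"
    and growth: "\<And>s. 0 < s \<Longrightarrow> s \<le> s0 \<Longrightarrow> (\<Sum>i | i \<in> N \<and> \<delta> i < s. w i) \<le> B * s powr p"
    and s: "0 < s" "s \<le> s0"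
  shows "(\<Sum>i | i \<in> N \<and> \<delta> i < s. w i / \<delta> i) \<le> 2 * B / (1 - 2 powr (1 - p)) * s powr (p - 1)"
proof -
  have q: "2 powr (1 - p) < (1::real)" using p by (simp add: powr_less_one)
  \<comment> \<open>\<open>A\<close> is the solution of
    \<open>A = 2 * B + A * 2 powr (1 - p)\<close>, which closes the induction over the
    shells.\<close>
  define A where "A = 2 * B / (1 - 2 powr (1 - p))"
  have A0: "0 \<le> A" using B q by (simp add: A_def)
  have A1: "2 * B = A - A * 2 powr (1 - p)"
  proof -
    have "A * (1 - 2 powr (1 - p)) = 2 * B" using q p by (simp add: A_def)
    then show ?thesis by (simp add: algebra_simps)
  qed
  have main: "(\<Sum>i | i \<in> N \<and> \<delta> i < s. w i / \<delta> i) \<le> A * s powr (p - 1)"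
    if "\<forall>i\<in>N. s / 2 ^ J \<le> \<delta> i" "0 < s" "s \<le> s0" for J s
    using that
  proof (induction J arbitrary: s)
    case 0
    then have "{i. i \<in> N \<and> \<delta> i < s} = {}" by auto
    then show ?case using A0 by (simp only: sum.empty) simp
  next
    case (Suc J)
    have IH: "(\<Sum>i | i \<in> N \<and> \<delta> i < s / 2. w i / \<delta> i) \<le> A * (s / 2) powr (p - 1)"
      using Suc.prems by (intro Suc.IH) (auto simp: field_simps)
    have split: "{i. i \<in> N \<and> \<delta> i < s} = {i. i \<in> N \<and> \<delta> i < s / 2} \<union> {i. i \<in> N \<and> s / 2 \<le> \<delta> i \<and> \<delta> i < s}"
      using Suc.prems by auto
    have "(\<Sum>i | i \<in> N \<and> s / 2 \<le> \<delta> i \<and> \<delta> i < s. w i / \<delta> i)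
        \<le> (\<Sum>i | i \<in> N \<and> s / 2 \<le> \<delta> i \<and> \<delta> i < s. w i * (2 / s))"
    proof (rule sum_mono)
      fix i assume "i \<in> {i. i \<in> N \<and> s / 2 \<le> \<delta> i \<and> \<delta> i < s}"
      then have "w i / \<delta> i \<le> w i / (s / 2)"
        using nn Suc.prems by (intro divide_left_mono) auto
      then show "w i / \<delta> i \<le> w i * (2 / s)" by simp
    qed
    also have "\<dots> \<le> (\<Sum>i | i \<in> N \<and> \<delta> i < s. w i * (2 / s))"
      using fin nn Suc.prems by (intro sum_mono2) auto
    also have "\<dots> = (\<Sum>i | i \<in> N \<and> \<delta> i < s. w i) * (2 / s)"
      by (rule sum_distrib_right[symmetric])
    also have "\<dots> \<le> (B * s powr p) * (2 / s)"
      using growth[of s] Suc.prems by (intro mult_right_mono) auto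
    also have "\<dots> = 2 * B * s powr (p - 1)"
      using Suc.prems by (simp add: powr_diff)
    finally have far: "(\<Sum>i | i \<in> N \<and> s / 2 \<le> \<delta> i \<and> \<delta> i < s. w i / \<delta> i) \<le> 2 * B * s powr (p - 1)" .
    have "(s / 2) powr (p - 1) = s powr (p - 1) * 2 powr (1 - p)"
      using Suc.prems by (simp add: powr_divide powr_diff)
    then have eq: "A * (s / 2) powr (p - 1) + 2 * B * s powr (p - 1) = A * s powr (p - 1)"
      by (simp only: A1) (simp add: algebra_simps)
    have "(\<Sum>i | i \<in> N \<and> \<delta> i < s. w i / \<delta> i) =
      (\<Sum>i | i \<in> N \<and> \<delta> i < s / 2. w i / \<delta> i) + (\<Sum>i | i \<in> N \<and> s / 2 \<le> \<delta> i \<and> \<delta> i < s. w i / \<delta> i)"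
      unfolding split using fin by (intro sum.union_disjoint) auto
    then show ?case using IH far eq by linarith
  qed
  \<comment> \<open>A finite \<open>N\<close> keeps \<open>\<delta>\<close> away from zero, so
    finitely many shells exhaust it.\<close>
  have "\<exists>J. \<forall>i\<in>N. s / 2 ^ J \<le> \<delta> i"
  proof (cases "N = {}")
    case False
    have "0 < Min (\<delta> ` N)" using fin False nn(2) by simp
    then have "\<exists>J. (1/2) ^ J < Min (\<delta> ` N) / s"
      using s by (intro real_arch_pow_inv) auto
    then obtain J where "(1/2) ^ J < Min (\<delta> ` N) / s" by blast
    then have "s / 2 ^ J < Min (\<delta> ` N)" using s by (simp add: field_simps power_one_over)
    then have "\<forall>i\<in>N. s / 2 ^ J \<le> \<delta> i" using fin
      by (metis Min.coboundedI finite_imageI imageI less_le_trans less_imp_le)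
    then show ?thesis ..
  qed auto
  then obtain J where "\<forall>i\<in>N. s / 2 ^ J \<le> \<delta> i" ..
  from main[OF this s] show ?thesis by (simp add: A_def)
qed

text \<open>Take for \<open>m n\<close> the infimum over \<open>T n\<close> of the budget that the
  earlier masses leave, or zero if it is negative. The budget is only respected when
  \<open>m n > 0\<close>, since earlier masses may already exceed it; and it is only half used up
  because the infimum need not be attained.\<close>

lemma greedy_masses:
  fixes D :: "nat \<Rightarrow> real \<Rightarrow> nat set" and b :: "nat \<Rightarrow> real \<Rightarrow> real" and T :: "nat \<Rightarrow> real set"
  assumes D: "\<And>n t. D n t \<subseteq> {..<n}" and T: "\<And>n. T n \<noteq> {}"
    and \<epsilon>: "\<And>n. 0 < \<epsilon> n" "\<And>n t. t \<in> T n \<Longrightarrow> \<epsilon> n \<le> b n t"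
  shows "\<exists>m. \<forall>n. 0 \<le> m n \<and> (\<forall>t\<in>T n. 0 < m n \<longrightarrow> m n + sum m (D n t) \<le> b n t) \<and>
    (\<exists>t\<in>T n. b n t / 2 \<le> m n + sum m (D n t))"
proof -
  define P where "P m n v \<longleftrightarrow> 0 \<le> v \<and> (\<forall>t\<in>T n. 0 < v \<longrightarrow> v + sum m (D n t) \<le> b n t) \<and>
     (\<exists>t\<in>T n. b n t / 2 \<le> v + sum m (D n t))" for m :: "nat \<Rightarrow> real" and n v
  have "\<exists>m. \<forall>n. P m n (m n)"
  proof (rule dependent_wf_choice[of less_than P])
    show "wf less_than" by simp
  next
    fix f g :: "nat \<Rightarrow> real" and n v
    assume "\<And>z. (z, n) \<in> less_than \<Longrightarrow> f z = g z"
    then have "sum f (D n t) = sum g (D n t)" for t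
      using D[of n t] by (intro sum.cong) auto
    then show "P f n v = P g n v" by (simp add: P_def)
  next
    fix n and f :: "nat \<Rightarrow> real"
    assume "\<And>k. (k, n) \<in> less_than \<Longrightarrow> P f k (f k)"
    then have f0: "0 \<le> f k" if "k < n" for k using that by (auto simp: P_def)
    define g where "g t = b n t - sum f (D n t)" for t
    have "sum f (D n t) \<le> sum f {..<n}" for t
      using D[of n t] f0 by (intro sum_mono2) auto
    then have "- sum f {..<n} \<le> g t" if "t \<in> T n" for t
      using \<epsilon>(1)[of n] \<epsilon>(2)[OF that] by (auto simp: g_def) (smt (verit))
    then have bdd: "bdd_below (g ` T n)" by (auto intro!: bdd_belowI2)
    define v where "v = max 0 (Inf (g ` T n))"
    have "v + sum f (D n t) \<le> b n t" if "t \<in> T n" "0 < v" for t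
      using cINF_lower[OF bdd that(1)] that(2) by (simp add: v_def g_def)
    moreover have "\<exists>t\<in>T n. b n t / 2 \<le> v + sum f (D n t)"
    proof -
      \<comment> \<open>The slack \<open>\<epsilon> n / 2\<close> is at most half of every budget
        \<open>b n t\<close>, so a near-minimiser \<open>t\<close> is half saturated.\<close>
      have "Inf (g ` T n) < v + \<epsilon> n / 2" using \<epsilon>(1)[of n] by (simp add: v_def)
      then obtain t where t: "t \<in> T n" "g t < v + \<epsilon> n / 2"
        using cInf_less_iff[of "g ` T n"] T[of n] bdd by auto
      then have "b n t / 2 \<le> v + sum f (D n t)"
        using \<epsilon>(2)[OF t(1)] by (simp add: g_def)
      then show ?thesis using t(1) by blast
    qed
    ultimately show "\<exists>v. P f n v" by (intro exI[of _ v]) (auto simp: P_def v_def)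
  qed
  then show ?thesis by (simp only: P_def)
qed

section \<open>Potentials and covers in a quasi-ultrametric space\<close>

locale quasi_ultrametric =
  fixes d :: "'a \<Rightarrow> 'a \<Rightarrow> real" and K :: real
  assumes K_ge_1: "1 \<le> K"
    and d_self: "d x x = 0"
    and d_nonneg: "0 \<le> d x y"
    and d_commute: "d x y = d y x"
    and d_triangle: "d x y \<le> K * max (d x z) (d z y)"
begin

lemma d_triangle_less:
  assumes "d x z < a" "d z y < a" shows "d x y < K * a"
proof -
  have "K * max (d x z) (d z y) < K * a" using assms K_ge_1 by (intro mult_strict_left_mono) auto
  then show ?thesis using d_triangle[of x y z] by linarith
qed

text \<open>The larger of the two distances in the triangle inequality through \<open>x\<close> must
  be \<open>d o' x\<close>, since \<open>K * d x y\<close> falls short of \<open>d o' y\<close>.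
  With \<open>d_origin_ge\<close>, points that are close relative to their distance from
  \<open>o'\<close> have comparable distances from it.\<close>

lemma d_origin_le:
  assumes "d x y < c * d o' y" "K * c \<le> 1"
  shows "d o' y \<le> K * d o' x"
proof (rule ccontr)
  assume *: "\<not> ?thesis"
  have "K * d x y < K * (c * d o' y)" using assms K_ge_1 by (intro mult_strict_left_mono) auto
  also have "\<dots> = (K * c) * d o' y" by simp
  also have "\<dots> \<le> 1 * d o' y" using assms d_nonneg by (intro mult_right_mono) auto
  finally show False using d_triangle[of o' y x] * by (auto simp: max_def split: if_splits)
qed

lemma d_origin_ge:
  assumes "d x y < c * d o' y" "c \<le> 1"
  shows "d o' x \<le> K * d o' y"
proof -
  have "c * d o' y \<le> 1 * d o' y" using assms d_nonneg by (intro mult_right_mono) auto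
  then have "d y x \<le> d o' y" using assms d_commute[of x y] by simp
  then show ?thesis using d_triangle[of o' x y] by simp
qed

text \<open>Around a point \<open>x\<close> outside the small balls, the mass near \<open>x\<close> in a ball \<open>B(x, s)\<close> is controlled by
  the constraint imposed when the last point of that ball was added; points with
  \<open>d x (y i) \<ge> e * d o' (y i)\<close> only contribute a multiple of \<open>\<Sum>i. m i / d o' (y i)\<close>.\<close>

lemma potential_bound:
  fixes p :: real and y :: "nat \<Rightarrow> 'a" and m \<rho> :: "nat \<Rightarrow> real"
  defines "c \<equiv> 1 / (2 * K)"
  defines "e \<equiv> c / K ^ 3"
  defines "B \<equiv> K * (K ^ 2) powr p"
  assumes p: "1 < p"
    and R: "\<And>i. i < n \<Longrightarrow> 0 < d o' (y i)" and \<rho>: "\<And>i. i < n \<Longrightarrow> 0 < \<rho> i"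
    and m0: "\<And>i. i < n \<Longrightarrow> 0 \<le> m i"
    and m: "\<And>i t. i < n \<Longrightarrow> \<rho> i \<le> t \<Longrightarrow> t \<le> c * d o' (y i) \<Longrightarrow> 0 < m i \<Longrightarrow>
      m i + sum m {k. k < i \<and> d (y i) (y k) < t} \<le> d o' (y i) * (t / d o' (y i)) powr p"
    and x: "\<And>i. i < n \<Longrightarrow> \<rho> i \<le> d x (y i)"
  shows "(\<Sum>i<n. m i / d x (y i)) \<le>
    2 * B / (1 - 2 powr (1 - p)) * (e * K) powr (p - 1) + (\<Sum>i<n. m i / d o' (y i)) / e"
proof -
  have K: "0 < K" "1 \<le> K" using K_ge_1 by auto
  have c: "0 < c" "c \<le> 1" "K * c \<le> 1" using K by (auto simp: c_def field_simps)
  have K3: "1 \<le> K ^ 3" using K by simp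
  have e: "0 < e" "e \<le> c" using c K3 K by (auto simp: e_def field_simps)
  have e': "K * e \<le> 1" "e \<le> 1" using e c K mult_left_mono[of e c K] by linarith+
  have q: "2 powr (1 - p) < (1::real)" using p by (simp add: powr_less_one)
  define X where "X = d o' x"
  \<comment> \<open>Near indices that carry mass. By \<open>NX\<close> the distance of their centres
    from \<open>o'\<close> agrees with that of \<open>x\<close> up to the factor
    \<open>K\<close>.\<close>
  define N where "N = {i. i < n \<and> d x (y i) < e * d o' (y i) \<and> 0 < m i}"
  have finN: "finite N" by (simp add: N_def)
  have dpos: "0 < d x (y i)" if "i < n" for i using x[OF that] \<rho>[OF that] by linarith
  have NX: "d o' (y i) \<le> K * X" "X \<le> K * d o' (y i)" if "i \<in> N" for i
    using that d_origin_le[of x "y i" e o'] d_origin_ge[of x "y i" e o'] e' by (auto simp: N_def X_def)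
  have Npos: "0 < X" if "i \<in> N" for i
  proof -
    have "0 < K * X" using R[of i] NX(1)[OF that] that by (auto simp: N_def)
    then show ?thesis using K by (simp add: zero_less_mult_iff)
  qed
  have near: "(\<Sum>i\<in>N. m i / d x (y i)) \<le> 2 * B / (1 - 2 powr (1 - p)) * (e * K) powr (p - 1)"
  proof (cases "N = {}")
    case True
    then show ?thesis using q K by (simp add: B_def)
  next
    case False
    then have X: "0 < X" using Npos by blast
    \<comment> \<open>The scale \<open>s0\<close> exceeds every near distance, and by the choice of
      \<open>e\<close> the radius \<open>K * s\<close> with \<open>s \<le> s0\<close> stays in the
      range of the constraint: \<open>K * (e * K * X) \<le> e * K ^ 3 * d o' (y i) = c * d o' (y
      i)\<close>.\<close>
    define s0 where "s0 = e * K * X"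
    have s0: "0 < s0" using e K X by (simp add: s0_def)
    have growth: "(\<Sum>i | i \<in> N \<and> d x (y i) < s. m i) \<le> (B * X / X powr p) * s powr p"
      if s: "0 < s" "s \<le> s0" for s
    proof (cases "{i. i \<in> N \<and> d x (y i) < s} = {}")
      case True
      show ?thesis unfolding True using X K by (simp add: B_def)
    next
      case False
      define M where "M = {i. i \<in> N \<and> d x (y i) < s}"
      \<comment> \<open>The last index with mass in the ball: all other members precede it and lie
        within \<open>K * s\<close> of \<open>y i\<close>, so its single constraint bounds the mass
        of the whole ball.\<close>
      define i where "i = Max M"
      have finM: "finite M" using finN by (simp add: M_def)
      have iM: "i \<in> M" unfolding i_def using False finM by (intro Max_in) (auto simp: M_def)
      then have iN: "i \<in> N" "i < n" "0 < m i" "d x (y i) < s" by (auto simp: M_def N_def)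
      have ge: "k \<le> i" if "k \<in> M" for k using that finM by (simp add: i_def)
      let ?R = "d o' (y i)"
      have R0: "0 < ?R" using R iN by simp
      have sub: "M \<subseteq> insert i {k. k < i \<and> d (y i) (y k) < K * s}"
      proof
        fix k assume k: "k \<in> M"
        have "d (y i) (y k) < K * s"
          using k iN d_triangle_less[of "y i" x s "y k"] by (auto simp: M_def d_commute)
        then show "k \<in> insert i {k. k < i \<and> d (y i) (y k) < K * s}" using ge[OF k] by auto
      qed
      have "sum m M \<le> sum m (insert i {k. k < i \<and> d (y i) (y k) < K * s})"
        using sub iN m0 by (intro sum_mono2) auto
      also have "\<dots> = m i + sum m {k. k < i \<and> d (y i) (y k) < K * s}" by simp
      also have "\<dots> \<le> ?R * (K * s / ?R) powr p"
      proof (rule m)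
        have "\<rho> i \<le> s" using x[of i] iN by simp
        also have "s \<le> K * s" using K s by simp
        finally show "\<rho> i \<le> K * s" .
        have "K * s \<le> K * (e * K * X)" using s K by (intro mult_left_mono) (auto simp: s0_def)
        also have "\<dots> = e * K ^ 2 * X" by (simp add: power2_eq_square)
        also have "\<dots> \<le> e * K ^ 2 * (K * ?R)" using NX(2)[OF iN(1)] e K by (intro mult_left_mono) auto
        also have "\<dots> = c * ?R" using K by (simp add: e_def power2_eq_square power3_eq_cube)
        finally show "K * s \<le> c * ?R" .
      qed (use iN in auto)
      also have "\<dots> \<le> (K * X) * (K ^ 2 * s / X) powr p"
      proof (intro mult_mono powr_mono2)
        have "K * s * X \<le> K * s * (K * ?R)" using NX(2)[OF iN(1)] K s by (intro mult_left_mono) auto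
        then show "K * s / ?R \<le> K ^ 2 * s / X"
          using R0 X by (simp add: field_simps power2_eq_square)
      qed (use NX(1)[OF iN(1)] p K s R0 X in auto)
      also have "\<dots> = (B * X / X powr p) * s powr p"
        using X s K by (simp add: B_def powr_mult powr_divide)
      finally show ?thesis by (simp add: M_def)
    qed
    have all: "{i. i \<in> N \<and> d x (y i) < s0} = N"
    proof -
      have "d x (y i) < s0" if "i \<in> N" for i
      proof -
        have "e * d o' (y i) \<le> s0" using NX(1)[OF that] e by (auto simp: s0_def mult.assoc intro!: mult_left_mono)
        then show ?thesis using that by (auto simp: N_def)
      qed
      then show ?thesis by auto
    qed
    \<comment> \<open>In the dyadic estimate the powers of \<open>X\<close> cancel, which makes the
      bound independent of \<open>x\<close>.\<close>
    have "(\<Sum>i | i \<in> N \<and> d x (y i) < s0. m i / d x (y i)) \<le>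
        2 * (B * X / X powr p) / (1 - 2 powr (1 - p)) * s0 powr (p - 1)"
      using finN m0 dpos p growth s0 X K
      by (intro sum_div_le_of_growth[where ?s0.0 = s0]) (auto simp: N_def B_def)
    moreover have "s0 powr (p - 1) = (e * K) powr (p - 1) * (X powr p / X)"
      using X e K by (simp add: s0_def powr_mult powr_diff)
    moreover have "2 * (B * X / X powr p) / (1 - 2 powr (1 - p)) * ((e * K) powr (p - 1) * (X powr p / X)) =
        2 * B / (1 - 2 powr (1 - p)) * (e * K) powr (p - 1)"
      using X by simp
    ultimately show ?thesis unfolding all by simp
  qed
  have far: "m i / d x (y i) \<le> m i / d o' (y i) / e" if "i \<in> {..<n} - N" for i
  proof (cases "0 < m i")
    case True
    then have "e * d o' (y i) \<le> d x (y i)" using that by (auto simp: N_def)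
    then have "m i / d x (y i) \<le> m i / (e * d o' (y i))"
      using True R[of i] dpos[of i] e that by (intro divide_left_mono) auto
    then show ?thesis by (simp add: mult.commute)
  next
    case False
    then have "m i = 0" using m0[of i] that by auto
    then show ?thesis by simp
  qed
  have "(\<Sum>i<n. m i / d x (y i)) = (\<Sum>i\<in>N. m i / d x (y i)) + (\<Sum>i\<in>{..<n} - N. m i / d x (y i))"
    by (subst sum.subset_diff[of N]) (auto simp: N_def)
  also have "(\<Sum>i\<in>{..<n} - N. m i / d x (y i)) \<le> (\<Sum>i\<in>{..<n} - N. m i / d o' (y i) / e)"
    using far by (intro sum_mono)
  also have "\<dots> \<le> (\<Sum>i<n. m i / d o' (y i) / e)"
    using m0 R e by (intro sum_mono2) (auto intro!: divide_nonneg_nonneg simp: less_imp_le)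
  finally show ?thesis using near by (simp add: sum_divide_distrib)
qed

text \<open>The radii \<open>t i\<close> are unbounded, so the Vitali selection is by the relative radius
  \<open>t i / d o' (y i)\<close>; this suffices because intersecting balls have centres at comparable
  distance from the origin.\<close>

lemma greedy_cover:
  fixes p :: real and y :: "nat \<Rightarrow> 'a" and m t :: "nat \<Rightarrow> real"
  defines "c \<equiv> 1 / (2 * K)"
  assumes p: "1 < p" and R: "\<And>i. 0 < d o' (y i)"
    and t: "\<And>i. 0 < t i" "\<And>i. t i \<le> c * d o' (y i)"
    and m0: "\<And>i. 0 \<le> m i"
    and m: "\<And>i. d o' (y i) * (t i / d o' (y i)) powr p / 2 \<le> m i + sum m {k. k < i \<and> d (y i) (y k) < t i}"
    and Q: "\<And>n. (\<Sum>i<n. m i / d o' (y i)) \<le> Q"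
  shows "\<exists>S. (\<Union>i. {z. d (y i) z < t i}) \<subseteq> (\<Union>j\<in>S. {z. d (y j) z < 2 * K ^ 4 * t j}) \<and>
    (\<forall>S0. finite S0 \<and> S0 \<subseteq> S \<longrightarrow> (\<Sum>j\<in>S0. (t j / d o' (y j)) powr p) \<le> 2 * K * Q)"
proof -
  have K: "0 < K" "1 \<le> K" using K_ge_1 by auto
  have c: "0 < c" "c \<le> 1" "K * c \<le> 1" using K by (auto simp: c_def field_simps)
  \<comment> \<open>\<open>D i\<close> collects indices, not points: those up to \<open>i\<close>
    whose centres lie in the ball of radius \<open>t i\<close>. It is finite, and disjoint sets
    \<open>D j\<close> share no mass.\<close>
  define D where "D i = {k. k \<le> i \<and> d (y i) (y k) < t i}" for i
  have self: "i \<in> D i" for i using t(1)[of i] by (simp add: D_def d_self)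
  have Rle: "d o' (y k) \<le> K * d o' (y i)" if "k \<in> D i" for i k
    using that t(2)[of i] d_origin_ge[of "y k" "y i" c o'] c by (auto simp: D_def d_commute)
  have Rge: "d o' (y i) \<le> K * d o' (y k)" if "k \<in> D i" for i k
    using that t(2)[of i] d_origin_le[of "y k" "y i" c o'] c by (auto simp: D_def d_commute)
  have size: "0 < t i / d o' (y i)" "t i / d o' (y i) \<le> c" for i
    using t[of i] R[of i] by (simp_all add: field_simps)
  have "\<exists>S. disjoint_family_on D S \<and>
      (\<forall>i. \<exists>j\<in>S. D i \<inter> D j \<noteq> {} \<and> t i / d o' (y i) \<le> 2 * (t j / d o' (y j)))"
    by (rule Vitali_finite_overlap[of "\<lambda>i. t i / d o' (y i)" c D]) (use size self in blast)+
  then obtain S where S: "disjoint_family_on D S"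
      and cover: "\<And>i. \<exists>j\<in>S. D i \<inter> D j \<noteq> {} \<and> t i / d o' (y i) \<le> 2 * (t j / d o' (y j))"
    by auto
  show ?thesis
  proof (intro exI[of _ S] conjI allI impI)
    show "(\<Union>i. {z. d (y i) z < t i}) \<subseteq> (\<Union>j\<in>S. {z. d (y j) z < 2 * K ^ 4 * t j})"
    proof clarify
      fix i z assume z: "d (y i) z < t i"
      \<comment> \<open>The common index \<open>l\<close> makes \<open>y i\<close> and
        \<open>y j\<close> comparable in distance from \<open>o'\<close>, so the bound on relative
        radii turns into one on the radii, \<open>t i \<le> 2 * K ^ 2 * t j\<close>; two triangle
        inequalities, through \<open>y i\<close> and \<open>y l\<close>, then give the factor
        \<open>2 * K ^ 4\<close>.\<close>
      obtain j l where j: "j \<in> S" "l \<in> D i" "l \<in> D j" "t i / d o' (y i) \<le> 2 * (t j / d o' (y j))"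
        using cover[of i] by blast
      have "d o' (y i) \<le> K * (K * d o' (y j))"
        using Rge[OF j(2)] Rle[OF j(3)] K by (meson mult_left_mono order_trans less_imp_le)
      then have ratio: "d o' (y i) \<le> K ^ 2 * d o' (y j)" by (simp add: power2_eq_square mult.assoc)
      have "t i \<le> 2 * (t j / d o' (y j)) * d o' (y i)" using j(4) R[of i] by (simp add: field_simps)
      also have "\<dots> \<le> 2 * (t j / d o' (y j)) * (K ^ 2 * d o' (y j))"
        using ratio t(1)[of j] R[of j] by (intro mult_left_mono) auto
      also have "\<dots> = 2 * K ^ 2 * t j" using R[of j] by simp
      finally have ti: "t i \<le> 2 * K ^ 2 * t j" .
      have K2: "1 \<le> K ^ 2" using K by simp
      have tj: "t j \<le> 2 * K ^ 2 * t j" using t(1)[of j] K2 by (auto simp: mult_le_cancel_right1)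
      have "d (y l) (y i) < 2 * K ^ 2 * t j" "d (y i) z < 2 * K ^ 2 * t j"
        using j z ti by (auto simp: D_def d_commute)
      then have 1: "d (y l) z < K * (2 * K ^ 2 * t j)" by (rule d_triangle_less)
      have "2 * K ^ 2 * t j \<le> K * (2 * K ^ 2 * t j)" using K t(1)[of j] by simp
      then have "d (y j) (y l) < K * (2 * K ^ 2 * t j)" using j tj by (auto simp: D_def)
      from d_triangle_less[OF this 1] have "d (y j) z < 2 * K ^ 4 * t j"
        by (simp add: power2_eq_square eval_nat_numeral algebra_simps)
      then show "z \<in> (\<Union>j\<in>S. {z. d (y j) z < 2 * K ^ 4 * t j})" using j by blast
    qed
  next
    fix S0 assume "finite S0 \<and> S0 \<subseteq> S"
    then have S0: "finite S0" "S0 \<subseteq> S" by auto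
    \<comment> \<open>Half saturation bounds the term by twice the mass of \<open>D j\<close> over
      \<open>d o' (y j)\<close>; replacing \<open>d o' (y j)\<close> by \<open>d o' (y k)\<close>
      costs a factor \<open>K\<close>.\<close>
    have "(t j / d o' (y j)) powr p \<le> 2 * K * (\<Sum>k\<in>D j. m k / d o' (y k))" for j
    proof -
      have Dj: "D j = insert j {k. k < j \<and> d (y j) (y k) < t j}"
        using self by (auto simp: D_def)
      have "(t j / d o' (y j)) powr p \<le> 2 * (\<Sum>k\<in>D j. m k) / d o' (y j)"
        using m[of j] R[of j] unfolding Dj by (simp add: field_simps)
      also have "\<dots> = 2 * (\<Sum>k\<in>D j. m k / d o' (y j))"
        by (simp only: sum_divide_distrib[symmetric] times_divide_eq_right)
      also have "(\<Sum>k\<in>D j. m k / d o' (y j)) \<le> (\<Sum>k\<in>D j. K * (m k / d o' (y k)))"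
      proof (rule sum_mono)
        fix k assume "k \<in> D j"
        then have "m k * d o' (y k) \<le> m k * (K * d o' (y j))" using Rle m0 by (intro mult_left_mono) auto
        then show "m k / d o' (y j) \<le> K * (m k / d o' (y k))"
          using R[of j] R[of k] by (simp add: field_simps)
      qed
      finally show ?thesis by (simp add: sum_distrib_left mult.assoc)
    qed
    then have "(\<Sum>j\<in>S0. (t j / d o' (y j)) powr p) \<le> (\<Sum>j\<in>S0. 2 * K * (\<Sum>k\<in>D j. m k / d o' (y k)))"
      by (intro sum_mono)
    also have "\<dots> = 2 * K * (\<Sum>j\<in>S0. \<Sum>k\<in>D j. m k / d o' (y k))" by (simp add: sum_distrib_left)
    also have "(\<Sum>j\<in>S0. \<Sum>k\<in>D j. m k / d o' (y k)) = (\<Sum>k\<in>(\<Union>j\<in>S0. D j). m k / d o' (y k))"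
      using S S0 by (intro sum.UNION_disjoint[symmetric]) (auto simp: disjoint_family_on_def D_def)
    also have "\<dots> \<le> Q"
    proof -
      have fin: "finite (\<Union>j\<in>S0. D j)" using S0 by (auto simp: D_def)
      then obtain n where "(\<Union>j\<in>S0. D j) \<subseteq> {..<n}" using finite_nat_iff_bounded by blast
      then have "(\<Sum>k\<in>(\<Union>j\<in>S0. D j). m k / d o' (y k)) \<le> (\<Sum>k<n. m k / d o' (y k))"
        using m0 R by (intro sum_mono2) (auto intro!: divide_nonneg_pos)
      then show ?thesis using Q[of n] by linarith
    qed
    finally show "(\<Sum>j\<in>S0. (t j / d o' (y j)) powr p) \<le> 2 * K * Q" using K by (simp add: mult_left_mono)
  qed
qed

end

section \<open>Smooth functions\<close>

lemma partial_eq: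
  assumes "(f has_derivative f') (at x)" shows "partial b f x = f' b"
  using frechet_derivative_at[OF assms] by (simp add: partial_def)

lemma partial_has_derivative:
  assumes "f differentiable at x" shows "(f has_derivative (\<lambda>b. partial b f x)) (at x)"
  using assms by (simp add: partial_def[abs_def] frechet_derivative_works)

lemma partial_cong:
  assumes "open S" "x \<in> S" "\<And>y. y \<in> S \<Longrightarrow> f y = g y"
  shows "partial b f x = partial b g x"
proof -
  have "(f has_derivative D) (at x) \<longleftrightarrow> (g has_derivative D) (at x)" for D
    using assms has_derivative_transform_within_open[of f D x UNIV S g]
      has_derivative_transform_within_open[of g D x UNIV S f] by auto
  then show ?thesis by (simp add: partial_def frechet_derivative_def)
qed

lemma differentiable_cong:
  assumes "open S" "x \<in> S" "\<And>y. y \<in> S \<Longrightarrow> f y = g y" "g differentiable at x"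
  shows "f differentiable at x"
proof -
  obtain D where "(g has_derivative D) (at x)" using assms(4) unfolding differentiable_def by blast
  then have "(f has_derivative D) (at x)"
    using assms by (intro has_derivative_transform_within_open[of g D x UNIV S f]) auto
  then show ?thesis by (rule differentiableI)
qed

text \<open>A family of differentiable functions which contains, on \<open>S\<close>, the partial
  derivatives of its members contains all their iterated derivatives. Smoothness thus reduces to one
  derivative rule for a well-chosen family.\<close>

lemma smooth_on_coinduct:
  assumes S: "open S" and f: "f \<in> F"
    and diff: "\<And>g x. g \<in> F \<Longrightarrow> x \<in> S \<Longrightarrow> g differentiable at x"
    and closed: "\<And>g b. g \<in> F \<Longrightarrow> b \<in> Basis \<Longrightarrow> \<exists>h\<in>F. \<forall>x\<in>S. partial b g x = h x"
  shows "smooth_on S f"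
  unfolding smooth_on_def
proof (intro allI impI ballI)
  fix bs :: "'a list" and x assume "set bs \<subseteq> Basis" and x: "x \<in> S"
  then have "\<exists>h\<in>F. \<forall>x\<in>S. iter_partial bs f x = h x"
  proof (induction bs)
    case Nil
    then show ?case using f by auto
  next
    case (Cons b bs)
    then obtain h where h: "h \<in> F" "\<And>x. x \<in> S \<Longrightarrow> iter_partial bs f x = h x" by auto
    obtain k where "k \<in> F" "\<And>x. x \<in> S \<Longrightarrow> partial b h x = k x"
      using closed[OF h(1), of b] Cons.prems by auto
    then show ?case using partial_cong[OF S _ h(2)] by auto
  qed
  then obtain h where "h \<in> F" "\<And>x. x \<in> S \<Longrightarrow> iter_partial bs f x = h x" by blast
  then show "iter_partial bs f differentiable at x"
    using differentiable_cong[OF S x] diff x by blast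
qed

lemma smooth_on_imp_differentiable: "smooth_on S f \<Longrightarrow> x \<in> S \<Longrightarrow> f differentiable at x"
  unfolding smooth_on_def by (drule spec[of _ "[]"]) simp

lemma smooth_on_has_derivative:
  "smooth_on S f \<Longrightarrow> x \<in> S \<Longrightarrow> (f has_derivative (\<lambda>b. partial b f x)) (at x)"
  by (intro partial_has_derivative smooth_on_imp_differentiable)

lemma smooth_on_imp_continuous_on: "smooth_on S f \<Longrightarrow> continuous_on S f"
  by (intro continuous_at_imp_continuous_on ballI differentiable_imp_continuous_within
      smooth_on_imp_differentiable)

lemma iter_partial_append: "iter_partial (bs @ cs) f = iter_partial bs (iter_partial cs f)"
  by (induction bs) auto

lemma smooth_on_partial:
  assumes "smooth_on S f" "b \<in> Basis" shows "smooth_on S (partial b f)"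
  unfolding smooth_on_def
proof (intro allI impI)
  fix bs :: "'a list" assume "set bs \<subseteq> Basis"
  \<comment> \<open>The head of the list is the outermost derivative, so the derivative
    \<open>b\<close>, taken first, goes to the end.\<close>
  then have "set (bs @ [b]) \<subseteq> Basis" using assms by auto
  then have "\<forall>x\<in>S. iter_partial (bs @ [b]) f differentiable at x"
    using assms unfolding smooth_on_def by blast
  then show "\<forall>x\<in>S. iter_partial bs (partial b f) differentiable at x"
    by (simp add: iter_partial_append)
qed

lemma smooth_on_subset: "smooth_on S f \<Longrightarrow> T \<subseteq> S \<Longrightarrow> smooth_on T f"
  unfolding smooth_on_def by blast

lemma smooth_on_Un: "smooth_on S f \<Longrightarrow> smooth_on T f \<Longrightarrow> smooth_on (S \<union> T) f"
  unfolding smooth_on_def by blast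

lemma smooth_on_cong:
  assumes "open S" "smooth_on S g" "\<And>x. x \<in> S \<Longrightarrow> f x = g x"
  shows "smooth_on S f"
proof -
  have "iter_partial bs f x = iter_partial bs g x" if "x \<in> S" for bs x
    using that by (induction bs arbitrary: x) (auto simp: assms intro!: partial_cong[OF assms(1)])
  note eq = this
  have "iter_partial bs f differentiable at x"
    if "set bs \<subseteq> Basis" "x \<in> S" for bs x
    by (rule differentiable_cong[OF assms(1), of x _ "iter_partial bs g"])
      (use that assms(2) eq in \<open>auto simp: smooth_on_def\<close>)
  then show ?thesis by (simp add: smooth_on_def)
qed

lemma smooth_on_const: "open S \<Longrightarrow> smooth_on S (\<lambda>x. c)"
proof (rule smooth_on_coinduct[where F = "range (\<lambda>c x. c)"])
  show "\<exists>h\<in>range (\<lambda>c x. c). \<forall>x\<in>S. partial b g x = h x" if "g \<in> range (\<lambda>c (x::'a). c)" for g b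
    using that partial_eq[OF has_derivative_const] by (intro bexI[of _ "\<lambda>x. 0"]) auto
qed auto

section \<open>Closure properties of smooth functions\<close>

text \<open>Derivatives of products and compositions are sums of products, so this algebra, unlike
  products or compositions alone, is closed under partial derivatives. Only smooth functions are
  substituted in \<open>comp\<close>, which keeps the chain rule inside the algebra.\<close>

inductive_set smooth_alg :: "'a::euclidean_space set \<Rightarrow> ('a \<Rightarrow> real) set" for S where
  base: "smooth_on S f \<Longrightarrow> f \<in> smooth_alg S"
| comp: "smooth_on UNIV (g :: real \<Rightarrow> real) \<Longrightarrow> smooth_on S f \<Longrightarrow> (\<lambda>x. g (f x)) \<in> smooth_alg S"
| add: "f \<in> smooth_alg S \<Longrightarrow> g \<in> smooth_alg S \<Longrightarrow> (\<lambda>x. f x + g x) \<in> smooth_alg S"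
| mult: "f \<in> smooth_alg S \<Longrightarrow> g \<in> smooth_alg S \<Longrightarrow> (\<lambda>x. f x * g x) \<in> smooth_alg S"

lemma partial_add:
  "f differentiable at x \<Longrightarrow> g differentiable at x \<Longrightarrow>
    partial b (\<lambda>x. f x + g x) x = partial b f x + partial b g x"
  by (rule partial_eq) (intro has_derivative_add partial_has_derivative)

lemma partial_mult:
  "f differentiable at x \<Longrightarrow> g differentiable at x \<Longrightarrow>
    partial b (\<lambda>x. f x * g x) x = f x * partial b g x + partial b f x * g x"
  by (rule partial_eq[OF has_derivative_mult]) (intro partial_has_derivative; assumption)+

lemma has_real_derivative_partial:
  assumes "g differentiable at (t::real)"
  shows "(g has_real_derivative partial 1 g t) (at t)"
proof -
  have "linear (\<lambda>b. partial b g t)"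
    using partial_has_derivative[OF assms] by (rule has_derivative_linear)
  then have "partial b g t = partial 1 g t * b" for b
    using linear_cmul[of "\<lambda>b. partial b g t" b 1] by simp
  then have "(\<lambda>b. partial b g t) = (*) (partial 1 g t)" by blast
  then show ?thesis
    using partial_has_derivative[OF assms] by (simp add: has_field_derivative_def)
qed

lemma has_derivative_comp_real:
  assumes "g differentiable at (f x)" "f differentiable at x"
  shows "((\<lambda>x. g (f x)) has_derivative (\<lambda>b. partial 1 g (f x) * partial b f x)) (at x)"
  using has_derivative_compose[OF partial_has_derivative[OF assms(2)]
      has_real_derivative_partial[OF assms(1), unfolded has_field_derivative_def]] by simp

lemma smooth_alg_imp_smooth_on:
  assumes S: "open S" and "f \<in> smooth_alg S" shows "smooth_on S f"
proof -
  have diff: "f differentiable at x" if "f \<in> smooth_alg S" "x \<in> S" for f x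
    using that
  proof induction
    case (comp g f)
    then show ?case
      using has_derivative_comp_real[of g f x] smooth_on_imp_differentiable[of UNIV g "f x"]
        smooth_on_imp_differentiable[of S f x] by (auto simp: differentiable_def)
  qed (auto intro: smooth_on_imp_differentiable differentiable_mult)
  have closed: "\<exists>h\<in>smooth_alg S. \<forall>x\<in>S. partial b f x = h x"
    if "f \<in> smooth_alg S" "b \<in> Basis" for f b
    using that(1)
  proof induction
    case (base f)
    then show ?case using that(2) smooth_on_partial smooth_alg.base by blast
  next
    case (comp g f)
    have "(\<lambda>x. partial 1 g (f x) * partial b f x) \<in> smooth_alg S"
      using comp that(2) by (intro smooth_alg.mult smooth_alg.comp smooth_alg.base smooth_on_partial) auto
    moreover have "partial b (\<lambda>x. g (f x)) x = partial 1 g (f x) * partial b f x" if "x \<in> S" for x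
      using comp that by (intro partial_eq[OF has_derivative_comp_real] smooth_on_imp_differentiable) auto
    ultimately show ?case by (intro bexI[of _ "\<lambda>x. partial 1 g (f x) * partial b f x"]) auto
  next
    case (add f g)
    then obtain h k where hk: "h \<in> smooth_alg S" "k \<in> smooth_alg S"
      "\<forall>x\<in>S. partial b f x = h x" "\<forall>x\<in>S. partial b g x = k x" by blast
    then have "(\<lambda>x. h x + k x) \<in> smooth_alg S" by (intro smooth_alg.add)
    moreover have "\<forall>x\<in>S. partial b (\<lambda>x. f x + g x) x = h x + k x"
      using hk add.hyps diff by (simp add: partial_add)
    ultimately show ?case by (intro bexI[of _ "\<lambda>x. h x + k x"]) auto
  next
    case (mult f g)
    then obtain h k where hk: "h \<in> smooth_alg S" "k \<in> smooth_alg S"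
      "\<forall>x\<in>S. partial b f x = h x" "\<forall>x\<in>S. partial b g x = k x" by blast
    then have "(\<lambda>x. f x * k x + h x * g x) \<in> smooth_alg S"
      using mult.hyps by (intro smooth_alg.add smooth_alg.mult)
    moreover have "\<forall>x\<in>S. partial b (\<lambda>x. f x * g x) x = f x * k x + h x * g x"
      using hk mult.hyps diff by (simp add: partial_mult)
    ultimately show ?case by (intro bexI[of _ "\<lambda>x. f x * k x + h x * g x"]) auto
  qed
  show ?thesis using S assms(2) diff closed by (rule smooth_on_coinduct)
qed

lemma smooth_on_add: "open S \<Longrightarrow> smooth_on S f \<Longrightarrow> smooth_on S g \<Longrightarrow> smooth_on S (\<lambda>x. f x + g x)"
  by (rule smooth_alg_imp_smooth_on) (assumption, intro smooth_alg.add smooth_alg.base)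

lemma smooth_on_mult: "open S \<Longrightarrow> smooth_on S f \<Longrightarrow> smooth_on S g \<Longrightarrow> smooth_on S (\<lambda>x. f x * g x)"
  by (rule smooth_alg_imp_smooth_on) (assumption, intro smooth_alg.mult smooth_alg.base)

lemma smooth_on_compose:
  fixes g :: "real \<Rightarrow> real"
  shows "open S \<Longrightarrow> smooth_on UNIV g \<Longrightarrow> smooth_on S f \<Longrightarrow> smooth_on S (\<lambda>x. g (f x))"
  by (rule smooth_alg_imp_smooth_on) (assumption, intro smooth_alg.comp)

lemma smooth_on_diff:
  assumes "open S" "smooth_on S f" "smooth_on S g" shows "smooth_on S (\<lambda>x. f x - g x)"
  using smooth_on_add[OF assms(1,2) smooth_on_mult[OF assms(1) smooth_on_const[OF assms(1), of "-1"] assms(3)]]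
  by simp

lemma smooth_on_sum:
  assumes "open S" "\<And>i. i \<in> I \<Longrightarrow> smooth_on S (f i)"
  shows "smooth_on S (\<lambda>x. \<Sum>i\<in>I. f i x)"
  using assms(2)
  by (induction I rule: infinite_finite_induct) (auto intro!: smooth_on_add smooth_on_const assms(1))

lemma smooth_on_inner_left: "smooth_on UNIV (\<lambda>x. x \<bullet> v)"
\<comment> \<open>The affine functions form a family closed under derivatives, which are
  constants.\<close>
proof (rule smooth_on_coinduct[where F = "{(\<lambda>x. c + x \<bullet> w) |c w. True}"])
  show "(\<lambda>x. x \<bullet> v) \<in> {(\<lambda>x. c + x \<bullet> w) |c w. True}"
    by (auto intro!: exI[of _ 0] exI[of _ v])
  have der: "((\<lambda>x. c + x \<bullet> w) has_derivative (\<lambda>b. b \<bullet> w)) (at x)" for c w and x :: 'a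
    by (auto intro!: derivative_eq_intros)
  show "g differentiable at x" if "g \<in> {(\<lambda>x. c + x \<bullet> w) |c w. True}" for g and x :: 'a
    using that der unfolding differentiable_def by blast
  show "\<exists>h\<in>{(\<lambda>x. c + x \<bullet> w) |c w. True}. \<forall>x\<in>UNIV. partial b g x = h x"
    if g: "g \<in> {(\<lambda>x. c + x \<bullet> w) |c w. True}" for g and b :: 'a
  proof -
    from g obtain c w where g: "g = (\<lambda>x. c + x \<bullet> w)" by blast
    show ?thesis unfolding g partial_eq[OF der]
      by (intro bexI[of _ "\<lambda>x. b \<bullet> w + x \<bullet> 0"] CollectI exI[of _ "b \<bullet> w"] exI[of _ 0]) auto
  qed
qed simp

lemma smooth_on_norm_square: "smooth_on UNIV (\<lambda>x. (x - a) \<bullet> (x - a))"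
proof -
  have "smooth_on UNIV (\<lambda>x. \<Sum>b\<in>Basis. (x \<bullet> b - a \<bullet> b) * (x \<bullet> b - a \<bullet> b))"
    by (intro smooth_on_sum smooth_on_mult smooth_on_diff smooth_on_inner_left smooth_on_const) auto
  then show ?thesis by (subst euclidean_inner) (simp add: inner_diff_left)
qed

section \<open>Bump functions\<close>

lemma tendsto_poly_times_exp_minus: "((\<lambda>s. poly P s * exp (- s)) \<longlongrightarrow> (0::real)) at_top"
proof -
  have "((\<lambda>s. \<Sum>i\<le>degree P. coeff P i * (s ^ i / exp s)) \<longlongrightarrow> (\<Sum>i\<le>degree P. coeff P i * 0)) at_top"
    by (intro tendsto_intros tendsto_power_div_exp_0)
  then show ?thesis
    by (simp add: poly_altdef sum_divide_distrib exp_minus field_simps)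
qed

text \<open>The flat function \<open>exp (- (1 / t))\<close>, extended by zero, with a polynomial
  factor in \<open>1 / t\<close>. Differentiation acts on the polynomial alone, sending
  \<open>P\<close> to \<open>[:0, 0, 1:] * (P - pderiv P)\<close>, so the family is closed under
  derivatives.\<close>

definition exp_tail :: "real poly \<Rightarrow> real \<Rightarrow> real" where
  "exp_tail P t = (if 0 < t then exp (- (1 / t)) * poly P (1 / t) else 0)"

lemma exp_tail_tendsto_0: "(exp_tail P \<longlongrightarrow> 0) (at 0)"
proof -
  have "((\<lambda>t. poly P (inverse t) * exp (- inverse t)) \<longlongrightarrow> 0) (at_right 0)"
    by (rule filterlim_compose[OF tendsto_poly_times_exp_minus filterlim_inverse_at_top_right])
  then have "(exp_tail P \<longlongrightarrow> 0) (at_right 0)"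
    by (rule Lim_transform_eventually)
      (auto simp: exp_tail_def eventually_at_filter inverse_eq_divide mult.commute)
  moreover have "(exp_tail P \<longlongrightarrow> 0) (at_left 0)"
    by (rule tendsto_eventually) (auto simp: exp_tail_def eventually_at_filter)
  ultimately show ?thesis by (simp add: filterlim_split_at)
qed

lemma exp_tail_has_derivative:
  "(exp_tail P has_real_derivative exp_tail ([:0, 0, 1:] * (P - pderiv P)) t) (at t)"
proof -
  consider "t < 0" | "t = 0" | "0 < t" by linarith
  then show ?thesis
  proof cases
    case 1
    then have "((\<lambda>t. 0) has_real_derivative exp_tail ([:0, 0, 1:] * (P - pderiv P)) t) (at t)"
      by (auto simp: exp_tail_def)
    then show ?thesis
      by (rule has_field_derivative_transform_within_open[of _ _ _ "{..<0}"]) (use 1 in \<open>auto simp: exp_tail_def\<close>)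
  next
    case 2
    \<comment> \<open>The difference quotient at \<open>0\<close> is again a member of the family,
      with the polynomial multiplied by the variable, and so tends to zero.\<close>
    have "exp_tail P h / h = exp_tail ([:0, 1:] * P) h" for h by (simp add: exp_tail_def)
    moreover have "exp_tail Q 0 = 0" for Q by (simp add: exp_tail_def)
    ultimately show ?thesis using exp_tail_tendsto_0[of "[:0, 1:] * P"]
      by (simp add: 2 DERIV_def)
  next
    case 3
    then have "((\<lambda>t. exp (- (1 / t)) * poly P (1 / t)) has_real_derivative
        exp_tail ([:0, 0, 1:] * (P - pderiv P)) t) (at t)"
      by (auto intro!: derivative_eq_intros simp: exp_tail_def field_simps power2_eq_square)
    then show ?thesis
      by (rule has_field_derivative_transform_within_open[of _ _ _ "{0<..}"]) (use 3 in \<open>auto simp: exp_tail_def\<close>)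
  qed
qed

lemma smooth_on_exp_tail: "smooth_on UNIV (exp_tail P)"
proof (rule smooth_on_coinduct[where F = "range exp_tail"])
  show "g differentiable at x" if "g \<in> range exp_tail" for g x
    using that exp_tail_has_derivative by (auto simp: differentiable_def has_field_derivative_def)
  show "\<exists>h\<in>range exp_tail. \<forall>x\<in>UNIV. partial b g x = h x" if "g \<in> range exp_tail" "b \<in> Basis" for g b
    using that partial_eq[OF exp_tail_has_derivative[unfolded has_field_derivative_def]] by auto
qed auto

lemma bump_function_exists:
  fixes z :: "'a::euclidean_space"
  assumes "0 < e"
  obtains \<phi> where "smooth_on UNIV \<phi>" "\<And>y. 0 \<le> \<phi> y" "\<And>y. 0 < \<phi> y \<longleftrightarrow> dist z y < e"
proof -
  \<comment> \<open>The argument of \<open>exp_tail\<close> is a polynomial in the coordinates of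
    \<open>y\<close>, positive exactly in the open ball.\<close>
  define \<phi> where "\<phi> y = exp_tail 1 (e\<^sup>2 - (y - z) \<bullet> (y - z))" for y
  have "smooth_on UNIV \<phi>" unfolding \<phi>_def
    by (rule smooth_on_compose[where g = "exp_tail 1"])
      (intro open_UNIV smooth_on_exp_tail smooth_on_diff smooth_on_const smooth_on_norm_square)+
  moreover have "0 \<le> \<phi> y" for y by (simp add: \<phi>_def exp_tail_def)
  moreover have "0 < \<phi> y \<longleftrightarrow> dist z y < e" for y
  proof -
    have "(y - z) \<bullet> (y - z) < e\<^sup>2 \<longleftrightarrow> norm (y - z) < e"
      using assms by (simp add: power2_norm_eq_inner[symmetric] abs_le_square_iff not_le[symmetric])
    then show ?thesis by (auto simp: \<phi>_def exp_tail_def dist_norm norm_minus_commute)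
  qed
  ultimately show ?thesis using that by blast
qed

text \<open>A derivative of the slice along \<open>b\<close> is the derivative of \<open>f\<close>
  along the basis vector \<open>(0, b)\<close> of the product. The joint smoothness of \<Gamma>
  thereby passes to each \<open>\<Gamma> x\<close>.\<close>

lemma smooth_on_slice:
  assumes f: "smooth_on S f" and S: "open S"
  shows "smooth_on {y. (x, y) \<in> S} (\<lambda>y. f (x, y))"
proof -
  let ?T = "{y. (x, y) \<in> S}"
  have T: "open ?T"
    using open_vimage[OF S, of "Pair x"] by (simp add: vimage_def continuous_on_Pair continuous_on_id)
  have der: "((\<lambda>y. g (x, y)) has_derivative (\<lambda>b. partial (0, b) g (x, y))) (at y)"
    if "g differentiable at (x, y)" for g y
    using has_derivative_compose[OF has_derivative_Pair[OF has_derivative_const has_derivative_ident]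
        partial_has_derivative[OF that]] by simp
  have eq: "iter_partial bs (\<lambda>y. f (x, y)) y = iter_partial (map (Pair 0) bs) f (x, y) \<and>
      (\<lambda>y. iter_partial (map (Pair 0) bs) f (x, y)) differentiable at y"
    if "set bs \<subseteq> Basis" "y \<in> ?T" for bs y
    using that
  proof (induction bs arbitrary: y)
    case Nil
    then show ?case
      using der[of f y] smooth_on_imp_differentiable[OF f] by (auto simp: differentiable_def)
  next
    case (Cons b bs)
    let ?g = "iter_partial (map (Pair 0) bs) f"
    have d: "iter_partial (map (Pair 0) cs) f differentiable at (x, y)"
      if "set cs \<subseteq> Basis" for cs
    proof -
      have "set (map (Pair 0) cs :: ('a \<times> 'b) list) \<subseteq> Basis" using that by (auto simp: Basis_prod_def)
      then show ?thesis using f Cons.prems(2) unfolding smooth_on_def by blast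
    qed
    have "partial b (iter_partial bs (\<lambda>y. f (x, y))) y = partial b (\<lambda>y. ?g (x, y)) y"
      using Cons by (intro partial_cong[OF T]) auto
    also have "\<dots> = partial (0, b) ?g (x, y)"
      using Cons.prems d by (intro partial_eq[OF der]) auto
    finally show ?case
      using der[OF d[of "b # bs"]] Cons.prems by (auto simp: differentiable_def)
  qed
  have "iter_partial bs (\<lambda>y. f (x, y)) differentiable at y" if "set bs \<subseteq> Basis" "y \<in> ?T" for bs y
    by (rule differentiable_cong[OF T that(2), of _ "\<lambda>y. iter_partial (map (Pair 0) bs) f (x, y)"])
      (use eq[OF that] eq[OF that(1)] in auto)
  then show ?thesis unfolding smooth_on_def by blast
qed

text \<open>Smoothness is a condition at each point, and the open sets \<open>U\<close> and
  \<open>- C\<close> cover the space; on the second the function is constant.\<close>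

lemma smooth_on_zero_outside:
  assumes "open U" "smooth_on U f" "closed C" "C \<subseteq> U" "\<And>y. y \<notin> C \<Longrightarrow> f y = 0"
  shows "smooth_on UNIV f"
proof -
  have "smooth_on (- C) f"
    using assms by (intro smooth_on_cong[OF _ smooth_on_const[of _ 0]]) auto
  then have "smooth_on (U \<union> - C) f" by (rule smooth_on_Un[OF assms(2)])
  moreover have "U \<union> - C = UNIV" using assms(4) by auto
  ultimately show ?thesis by simp
qed

section \<open>Integrals of compactly supported functions\<close>

lemma integrable_zero_outside_compact:
  fixes f :: "'a::euclidean_space \<Rightarrow> real"
  assumes "compact C" "continuous_on UNIV f" "\<And>y. y \<notin> C \<Longrightarrow> f y = 0"
  shows "integrable lborel f"
proof -
  have "integrable lborel (\<lambda>x. indicator C x *\<^sub>R f x)"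
    using assms by (intro borel_integrable_compact) (auto intro: continuous_on_subset)
  moreover have "(\<lambda>x. indicator C x *\<^sub>R f x) = f"
    using assms(3) by (auto simp: fun_eq_iff indicator_def)
  ultimately show ?thesis by simp
qed

text \<open>The difference quotients have integral zero by translation invariance.\<close>

lemma integral_partial_eq_0:
  fixes f :: "'a::euclidean_space \<Rightarrow> real"
  assumes f: "smooth_on UNIV f" and b: "b \<in> Basis"
    and C: "compact C" and supp: "\<And>y. y \<notin> C \<Longrightarrow> f y = 0"
  shows "(LINT y|lborel. partial b f y) = 0"
proof -
  have cf: "continuous_on UNIV f" and cp: "continuous_on UNIV (partial b f)"
    using f b smooth_on_partial smooth_on_imp_continuous_on by blast+
  have intf: "integrable lborel f" using C cf supp by (rule integrable_zero_outside_compact)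
  obtain r where r: "C \<subseteq> cball 0 r" using compact_imp_bounded[OF C] by (auto simp: bounded_iff subset_iff)
  have p0: "partial b f y = 0" if "y \<notin> C" for y
    using partial_cong[of "- C" y f "\<lambda>_. 0" b] that C supp
    by (simp add: compact_imp_closed open_Compl partial_eq[OF has_derivative_const])
  have "compact (partial b f ` C)" using C cp by (meson compact_continuous_image continuous_on_subset subset_UNIV)
  then obtain M where M: "\<And>y. y \<in> C \<Longrightarrow> \<bar>partial b f y\<bar> \<le> M"
    using compact_imp_bounded bounded_iff by (metis imageI real_norm_def)
  then have M': "\<bar>partial b f y\<bar> \<le> max M 0" for y
    using p0[of y] by (cases "y \<in> C") (auto simp: max_def, fastforce)
  have der: "((\<lambda>t. f (t *\<^sub>R b + y)) has_real_derivative partial b f (t *\<^sub>R b + y)) (at t)" for t y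
  proof -
    have "((\<lambda>t. f (t *\<^sub>R b + y)) has_derivative (\<lambda>s. partial (s *\<^sub>R b) f (t *\<^sub>R b + y))) (at t)"
      by (rule has_derivative_compose[OF _ smooth_on_has_derivative[OF f]])
        (auto intro!: derivative_eq_intros)
    moreover have "partial (s *\<^sub>R b) f x = partial b f x * s" for s x
      using linear_cmul[OF has_derivative_linear[OF smooth_on_has_derivative[OF f]], of x s b] by simp
    ultimately show ?thesis by (simp add: has_field_derivative_def)
  qed
  define h where "h n = inverse (real (Suc n))" for n
  have h: "0 < h n" "h n \<le> 1" for n by (auto simp: h_def field_simps)
  define q where "q n y = (f (h n *\<^sub>R b + y) - f y) / h n" for n y
  have distr: "(LINT y|lborel. f (a + y)) = (LINT y|lborel. f y)"
    and int_shift: "integrable lborel (\<lambda>y. f (a + y))" for a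
  proof -
    have m: "(+) a \<in> measurable lborel borel" "f \<in> borel_measurable borel"
      using intf by auto
    show "(LINT y|lborel. f (a + y)) = (LINT y|lborel. f y)"
      using integral_distr[OF m] by (simp add: lborel_distr_plus)
    show "integrable lborel (\<lambda>y. f (a + y))"
      using integrable_distr_eq[OF m] intf by (simp add: lborel_distr_plus)
  qed
  have q0: "integral\<^sup>L lborel (q n) = 0" for n
    unfolding q_def using distr int_shift intf by (simp add: Bochner_Integration.integral_diff)
  have "(\<lambda>n. integral\<^sup>L lborel (q n)) \<longlonglongrightarrow> (LINT y|lborel. partial b f y)"
  proof (rule integral_dominated_convergence)
    show "partial b f \<in> borel_measurable lborel"
      using cp by (simp add: borel_measurable_continuous_onI)
    show "q n \<in> borel_measurable lborel" for n
      unfolding q_def using int_shift[of "h n *\<^sub>R b"] intf by measurable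
    \<comment> \<open>By the mean value theorem the quotients obey the bound of the derivative; as
      \<open>h n \<le> 1\<close>, they vanish outside the ball enlarged by \<open>1\<close>.\<close>
    show "integrable lborel (\<lambda>y. indicator (cball 0 (r + 1)) y *\<^sub>R (max M 0))"
      by (intro borel_integrable_compact) auto
    show "AE y in lborel. (\<lambda>n. q n y) \<longlonglongrightarrow> partial b f y"
    proof (rule AE_I2)
      fix y
      have "(\<lambda>t. (f (t *\<^sub>R b + y) - f y) / t) \<midarrow>0\<rightarrow> partial b f y"
        using der[of y 0] by (simp add: DERIV_def)
      moreover have "h \<longlonglongrightarrow> 0" unfolding h_def by (rule LIMSEQ_inverse_real_of_nat)
      ultimately show "(\<lambda>n. q n y) \<longlonglongrightarrow> partial b f y"
        using h unfolding q_def LIMSEQ_SEQ_conv[symmetric] by (metis less_irrefl)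
    qed
    show "AE y in lborel. norm (q n y) \<le> indicator (cball 0 (r + 1)) y *\<^sub>R (max M 0)" for n
    proof (rule AE_I2)
      fix y
      show "norm (q n y) \<le> indicator (cball 0 (r + 1)) y *\<^sub>R (max M 0)"
      proof (cases "y \<in> cball 0 (r + 1)")
        case True
        obtain \<xi> where "f (h n *\<^sub>R b + y) - f y = (h n - 0) * partial b f (\<xi> *\<^sub>R b + y)"
          using MVT2[of 0 "h n" "\<lambda>t. f (t *\<^sub>R b + y)"] der h by fastforce
        then have "q n y = partial b f (\<xi> *\<^sub>R b + y)" using h[of n] by (simp add: q_def)
        then show ?thesis using True M' by simp
      next
        case False
        have "norm (h n *\<^sub>R b) \<le> 1" using h[of n] b by simp
        moreover have "norm y \<le> norm (h n *\<^sub>R b + y) + norm (h n *\<^sub>R b)"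
          using norm_triangle_ineq4[of "h n *\<^sub>R b + y" "h n *\<^sub>R b"] by simp
        ultimately have "y \<notin> C" "h n *\<^sub>R b + y \<notin> C" using False r by (auto simp: subset_iff)
        then show ?thesis using supp False by (simp add: q_def)
      qed
    qed
  qed
  then have "(\<lambda>n. 0::real) \<longlonglongrightarrow> (LINT y|lborel. partial b f y)" by (simp add: q0)
  then show ?thesis by (simp add: LIMSEQ_const_iff)
qed

text \<open>The set where \<open>f\<close> does not vanish is null because the integral is zero; it
  is also open, hence empty.\<close>

lemma continuous_nonneg_integral_0:
  fixes f :: "'a::euclidean_space \<Rightarrow> real"
  assumes "integrable lborel f" "continuous_on UNIV f" "\<And>y. 0 \<le> f y" "(LINT y|lborel. f y) = 0"
  shows "f y = 0"
proof (rule ccontr)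
  assume "f y \<noteq> 0"
  have "AE x in lborel. f x = 0"
    using assms by (subst integral_nonneg_eq_0_iff_AE[symmetric]) auto
  then have "{x. f x \<noteq> 0} \<in> null_sets lborel"
    by (subst (asm) AE_iff_null) (use assms in \<open>auto simp: borel_measurable_continuous_onI\<close>)
  then have "negligible {x. f x \<noteq> 0}"
    by (simp add: negligible_iff_null_sets null_sets_completionI)
  moreover have "open {x. f x \<noteq> 0}"
    using assms(2) by (intro open_Collect_neq) auto
  ultimately show False using open_not_negligible \<open>f y \<noteq> 0\<close> by blast
qed

section \<open>Harmonicity of the fundamental solution\<close>

text \<open>The components of the vector field V A grad u; \<open>div_flux\<close> is its
  divergence, that is, V times the operator. Where V is positive, the divergence and the operator
  have the same zeros, and the divergence is what integrates by parts against Lebesgue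
  measure.\<close>

definition flux :: "(real^'n \<Rightarrow> real) \<Rightarrow> (real^'n \<Rightarrow> real^'n^'n) \<Rightarrow> (real^'n \<Rightarrow> real) \<Rightarrow> 'n::finite \<Rightarrow> real^'n \<Rightarrow> real" where
  "flux V A u i y = (\<Sum>j\<in>UNIV. V y * A y $ i $ j * partial (axis j 1) u y)"

definition div_flux :: "(real^'n \<Rightarrow> real) \<Rightarrow> (real^'n \<Rightarrow> real^'n^'n) \<Rightarrow> (real^'n \<Rightarrow> real) \<Rightarrow> real^'n::finite \<Rightarrow> real" where
  "div_flux V A u y = (\<Sum>i\<in>UNIV. partial (axis i 1) (flux V A u i) y)"

lemma L_op_eq: "L_op V A u x = div_flux V A u x / V x"
  by (simp add: L_op_def div_flux_def flux_def[abs_def])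

lemma L_harmonic_iff:
  assumes "H1 V A"
  shows "L_harmonic V A U u \<longleftrightarrow> smooth_on U u \<and> (\<forall>x\<in>U. div_flux V A u x = 0)"
  using assms unfolding L_harmonic_def L_op_eq H1_def by (metis divide_eq_0_iff less_irrefl)

lemma smooth_on_flux:
  assumes "H1 V A" "open U" "smooth_on U u"
  shows "smooth_on U (flux V A u i)"
proof -
  have "smooth_on U V" "\<And>i j. smooth_on U (\<lambda>x. A x $ i $ j)"
    using assms(1) smooth_on_subset[of UNIV _ U] by (auto simp: H1_def)
  then show ?thesis unfolding flux_def[abs_def]
    using assms by (intro smooth_on_sum smooth_on_mult smooth_on_partial) auto
qed

lemma smooth_on_div_flux:
  assumes "H1 V A" "open U" "smooth_on U u"
  shows "smooth_on U (div_flux V A u)"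
  unfolding div_flux_def[abs_def]
  using assms by (intro smooth_on_sum smooth_on_partial smooth_on_flux) auto

lemma flux_cong:
  "open U \<Longrightarrow> x \<in> U \<Longrightarrow> (\<And>y. y \<in> U \<Longrightarrow> u y = v y) \<Longrightarrow> flux V A u i x = flux V A v i x"
  unfolding flux_def by (intro sum.cong refl arg_cong2[where f = "(*)"] partial_cong) auto

lemma div_flux_cong:
  assumes "open U" "x \<in> U" "\<And>y. y \<in> U \<Longrightarrow> u y = v y"
  shows "div_flux V A u x = div_flux V A v x"
  unfolding div_flux_def
  by (intro sum.cong refl partial_cong[OF assms(1,2)] flux_cong[OF assms(1)]) (auto simp: assms)

lemma partial_const: "partial b (\<lambda>x. c) x = 0"
  by (simp add: partial_eq[OF has_derivative_const])

lemma flux_const: "flux V A (\<lambda>x. c) i = (\<lambda>x. 0)"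
  by (simp add: flux_def fun_eq_iff partial_const)

lemma div_flux_const: "div_flux V A (\<lambda>x. c) x = 0"
  by (simp add: div_flux_def flux_const partial_const)

lemma partial_cmult: "f differentiable at x \<Longrightarrow> partial b (\<lambda>x. c * f x) x = c * partial b f x"
  by (rule partial_eq) (intro has_derivative_mult_right partial_has_derivative)

lemma partial_diff:
  "f differentiable at x \<Longrightarrow> g differentiable at x \<Longrightarrow>
    partial b (\<lambda>x. f x - g x) x = partial b f x - partial b g x"
  by (rule partial_eq) (intro has_derivative_diff partial_has_derivative)

lemma div_flux_linear:
  assumes H1: "H1 V A" and U: "open U" and u: "smooth_on U u" and v: "smooth_on U v" and x: "x \<in> U"
  shows "div_flux V A (\<lambda>x. u x + c * v x) x = div_flux V A u x + c * div_flux V A v x"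
proof -
  have d: "u differentiable at y" "v differentiable at y" "(\<lambda>x. c * v x) differentiable at y" if "y \<in> U" for y
    using that smooth_on_imp_differentiable u v by (auto intro!: differentiable_mult)
  have p: "partial b (\<lambda>x. u x + c * v x) y = partial b u y + c * partial b v y" if "y \<in> U" for b y
    using d[OF that] by (simp add: partial_add partial_cmult)
  have flux: "flux V A (\<lambda>x. u x + c * v x) i y = flux V A u i y + c * flux V A v i y" if "y \<in> U" for i y
    using that by (simp add: flux_def p algebra_simps sum.distrib sum_distrib_left)
  have df: "flux V A u i differentiable at x" "flux V A v i differentiable at x"
    "(\<lambda>x. c * flux V A v i x) differentiable at x" for i
    using smooth_on_imp_differentiable[OF smooth_on_flux[OF H1 U u] x]
      smooth_on_imp_differentiable[OF smooth_on_flux[OF H1 U v] x] by (auto intro!: differentiable_mult)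
  have "partial b (flux V A (\<lambda>x. u x + c * v x) i) x = partial b (flux V A u i) x + c * partial b (flux V A v i) x" for b i
  proof -
    have "partial b (flux V A (\<lambda>x. u x + c * v x) i) x = partial b (\<lambda>y. flux V A u i y + c * flux V A v i y) x"
      by (rule partial_cong[OF U x flux])
    then show ?thesis using df by (simp add: partial_add partial_cmult)
  qed
  then show ?thesis by (simp add: div_flux_def sum.distrib sum_distrib_left)
qed

lemma L_harmonic_linear:
  assumes "H1 V A" "open U" "L_harmonic V A U u" "L_harmonic V A U v"
  shows "L_harmonic V A U (\<lambda>x. u x + c * v x)"
  using assms div_flux_linear[OF assms(1,2), of u v] 
  by (auto simp: L_harmonic_iff intro!: smooth_on_add smooth_on_mult smooth_on_const)

lemma L_harmonic_const: "H1 V A \<Longrightarrow> open U \<Longrightarrow> L_harmonic V A U (\<lambda>x. c)"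
  by (simp add: L_harmonic_iff smooth_on_const div_flux_const)

lemma L_harmonic_sum:
  assumes "H1 V A" "open U" "finite I" "\<And>i. i \<in> I \<Longrightarrow> L_harmonic V A U (v i)"
  shows "L_harmonic V A U (\<lambda>x. \<Sum>i\<in>I. c i * v i x)"
  using assms(3,4)
proof (induction I rule: finite_induct)
  case empty
  then show ?case using L_harmonic_const[OF assms(1,2)] by simp
next
  case (insert i I)
  then have "L_harmonic V A U (\<lambda>x. (\<Sum>i\<in>I. c i * v i x) + c i * v i x)"
    by (intro L_harmonic_linear assms(1,2)) auto
  then show ?case using insert by (simp add: add.commute)
qed

lemma L_harmonic_subset: "L_harmonic V A U u \<Longrightarrow> W \<subseteq> U \<Longrightarrow> L_harmonic V A W u"
  unfolding L_harmonic_def by (auto intro: smooth_on_subset)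

section \<open>Green's identity and weak solutions\<close>

text \<open>The difference of the two integrands is the divergence of a compactly supported vector
  field, because the terms with two first derivatives cancel by the symmetry of \<open>A\<close>;
  such a divergence integrates to zero.\<close>

lemma green_identity:
  assumes H1: "H1 V A" and H2: "H2 A" and U: "open U" and g: "smooth_on U g"
    and \<phi>: "smooth_on UNIV \<phi>" and C: "compact C" "C \<subseteq> U" "\<And>y. y \<notin> C \<Longrightarrow> \<phi> y = 0"
  shows "(LINT y|lborel. g y * L_op V A \<phi> y * V y) = (LINT y|lborel. \<phi> y * div_flux V A g y)"
    and "integrable lborel (\<lambda>y. \<phi> y * div_flux V A g y)"
    and "continuous_on UNIV (\<lambda>y. \<phi> y * div_flux V A g y)"
proof -
  have V: "V y \<noteq> 0" for y using H1 unfolding H1_def by (metis less_irrefl)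
  have sym: "A y $ i $ j = A y $ j $ i" for y i j
    using H2 unfolding H2_def by (metis transpose_def vec_lambda_beta)
  have clC: "closed C" "open (- C)" using C(1) by (auto simp: compact_imp_closed)
  have \<phi>U: "smooth_on U \<phi>" using smooth_on_subset[OF \<phi>] by auto
  have flux0: "flux V A \<phi> i y = 0" "div_flux V A \<phi> y = 0" if "y \<notin> C" for i y
    using that C(3) flux_cong[OF clC(2), of y \<phi> "\<lambda>_. 0"] div_flux_cong[OF clC(2), of y \<phi> "\<lambda>_. 0"]
    by (auto simp: flux_const div_flux_const)
  define w where "w i y = g y * flux V A \<phi> i y - \<phi> y * flux V A g i y" for i y
  \<comment> \<open>Outside \<open>C\<close> both \<open>\<phi>\<close> and its flux vanish, so the
    field extends smoothly by zero although \<open>g\<close> is only smooth on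
    \<open>U\<close>.\<close>
  have w: "smooth_on UNIV (w i)" for i
    unfolding w_def using C clC flux0
    by (intro smooth_on_zero_outside[OF U _ clC(1) C(2)] smooth_on_diff smooth_on_mult g \<phi>U smooth_on_flux[OF H1] U) auto
  have w0: "w i y = 0" if "y \<notin> C" for i y using that C(3) flux0 by (simp add: w_def)
  let ?L = "\<lambda>y. g y * div_flux V A \<phi> y" and ?R = "\<lambda>y. \<phi> y * div_flux V A g y"
  have sL: "smooth_on UNIV ?L" and sR: "smooth_on UNIV ?R"
    using C clC flux0
    by (intro smooth_on_zero_outside[OF U _ clC(1) C(2)] smooth_on_mult g \<phi>U smooth_on_div_flux[OF H1] U; simp)+
  have cL: "continuous_on UNIV ?L" and cR: "continuous_on UNIV ?R"
    using sL sR smooth_on_imp_continuous_on by blast+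
  have iL: "integrable lborel ?L" and iR: "integrable lborel ?R"
    using C flux0 by (auto intro!: integrable_zero_outside_compact[OF C(1)] cL cR)
  have cw: "continuous_on UNIV (partial (axis i 1) (w i))" for i
    by (intro smooth_on_imp_continuous_on smooth_on_partial w) simp
  have dw0: "partial (axis i 1) (w i) y = 0" if "y \<notin> C" for i y
    using partial_cong[OF clC(2), of y "w i" "\<lambda>_. 0"] that w0 by (simp add: partial_const)
  have iw: "integrable lborel (partial (axis i 1) (w i))" for i
    using dw0 by (intro integrable_zero_outside_compact[OF C(1) cw])
  have div: "(\<Sum>i\<in>UNIV. partial (axis i 1) (w i) y) = ?L y - ?R y" for y
  proof (cases "y \<in> C")
    case False
    then show ?thesis using dw0 flux0 C(3) by simp
  next
    case True
    then have y: "y \<in> U" using C by blast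
    have d: "g differentiable at y" "\<phi> differentiable at y"
      "flux V A g i differentiable at y" "flux V A \<phi> i differentiable at y" for i
      using y g \<phi>U smooth_on_flux[OF H1 U] by (auto intro: smooth_on_imp_differentiable)
    have "partial (axis i 1) (w i) y =
        g y * partial (axis i 1) (flux V A \<phi> i) y + partial (axis i 1) g y * flux V A \<phi> i y
        - (\<phi> y * partial (axis i 1) (flux V A g i) y + partial (axis i 1) \<phi> y * flux V A g i y)" for i
      unfolding w_def using d by (simp add: partial_diff partial_mult differentiable_mult)
    moreover have "(\<Sum>i\<in>UNIV. partial (axis i 1) g y * flux V A \<phi> i y) =
        (\<Sum>i\<in>UNIV. partial (axis i 1) \<phi> y * flux V A g i y)"
      unfolding flux_def sum_distrib_left
      by (subst sum.swap) (intro sum.cong refl, simp add: sym mult_ac)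
    ultimately show ?thesis
      by (simp add: div_flux_def sum.distrib sum_subtractf sum_distrib_left)
  qed
  have "(LINT y|lborel. ?L y) - (LINT y|lborel. ?R y) = (LINT y|lborel. (\<Sum>i\<in>UNIV. partial (axis i 1) (w i) y))"
    using iL iR by (simp add: div)
  also have "\<dots> = (\<Sum>i\<in>UNIV. LINT y|lborel. partial (axis i 1) (w i) y)"
    using iw by (intro Bochner_Integration.integral_sum) auto
  also have "\<dots> = 0"
    using integral_partial_eq_0[OF w _ C(1) w0] by (intro sum.neutral) auto
  finally show "(LINT y|lborel. g y * L_op V A \<phi> y * V y) = (LINT y|lborel. ?R y)"
    using V by (simp add: L_op_eq)
  show "integrable lborel ?R" "continuous_on UNIV ?R" by fact+
qed

text \<open>If \<open>div_flux V A g\<close> were nonzero at some point of \<open>U\<close>, it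
  would keep its sign on a ball around it, and by Green's identity a bump function supported there
  would violate the weak equation.\<close>

lemma weakly_harmonic_imp_L_harmonic:
  assumes H1: "H1 V A" and H2: "H2 A" and U: "open U" and g: "smooth_on U g"
    and weak: "\<And>\<phi>. \<phi> \<in> test_functions U \<Longrightarrow> (LINT y|lborel. g y * L_op V A \<phi> y * V y) = 0"
  shows "L_harmonic V A U g"
proof (rule ccontr)
  let ?H = "div_flux V A g"
  assume "\<not> ?thesis"
  then obtain z where z: "z \<in> U" "?H z \<noteq> 0" using g by (auto simp: L_harmonic_iff[OF H1])
  \<comment> \<open>The factor \<open>?H z\<close> makes the sign positive near \<open>z\<close> in
    both cases.\<close>
  have cont: "continuous_on U (\<lambda>y. ?H y * ?H z)"
    using smooth_on_imp_continuous_on[OF smooth_on_div_flux[OF H1 U g]] by (intro continuous_intros)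
  have "open (U \<inter> (\<lambda>y. ?H y * ?H z) -` {0<..})"
    using cont U by (intro continuous_open_preimage) auto
  moreover have "z \<in> U \<inter> (\<lambda>y. ?H y * ?H z) -` {0<..}"
    using z by (auto simp: zero_less_mult_iff linorder_neq_iff)
  ultimately obtain e where e: "0 < e" "cball z e \<subseteq> U \<inter> (\<lambda>y. ?H y * ?H z) -` {0<..}"
    using open_contains_cball by blast
  obtain \<phi> where \<phi>: "smooth_on UNIV \<phi>" "\<And>y. 0 \<le> \<phi> y" "\<And>y. 0 < \<phi> y \<longleftrightarrow> dist z y < e"
    using bump_function_exists[OF e(1)] by blast
  have zero: "\<phi> y = 0" if "y \<notin> cball z e" for y
    using \<phi>(2)[of y] \<phi>(3)[of y] that by auto
  have supp: "supp \<phi> \<subseteq> cball z e"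
    unfolding supp_def by (intro closure_minimal closed_cball) (use zero in blast)
  then have "compact (supp \<phi>)"
    by (metis compact_cball compact_Int_closed closed_closure inf.absorb_iff2 supp_def)
  then have "\<phi> \<in> test_functions U" using \<phi> supp e unfolding test_functions_def by blast
  then have 0: "(LINT y|lborel. \<phi> y * ?H y) = 0"
    using weak green_identity(1)[OF H1 H2 U g \<phi>(1) compact_cball, of z e] zero e by auto
  have gi: "integrable lborel (\<lambda>y. \<phi> y * ?H y)" "continuous_on UNIV (\<lambda>y. \<phi> y * ?H y)"
    using green_identity(2,3)[OF H1 H2 U g \<phi>(1) compact_cball, of z e] zero e by auto
  have "(\<phi> z * ?H z) * ?H z = 0"
  proof (rule continuous_nonneg_integral_0[where f = "\<lambda>y. (\<phi> y * ?H y) * ?H z"])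
    show "0 \<le> \<phi> y * ?H y * ?H z" for y
    proof (cases "y \<in> cball z e")
      case True
      then have "0 < ?H y * ?H z" using e by blast
      then show ?thesis using \<phi>(2)[of y] by (simp add: mult.assoc)
    qed (simp add: zero)
    show "continuous_on UNIV (\<lambda>y. \<phi> y * ?H y * ?H z)" by (rule continuous_on_mult[OF gi(2) continuous_on_const])
  qed (use gi 0 in auto)
  then show False using z \<phi>(3)[of z] e(1) by auto
qed

text \<open>A test function supported off the pole vanishes at \<open>x\<close>, so the
  representation formula becomes the weak equation for \<open>\<Gamma> x\<close> there.\<close>

lemma FS_L_harmonic:
  assumes "H1 V A" "H2 A" "FS V A \<Gamma>"
  shows "L_harmonic V A (- {x}) (\<Gamma> x)"
proof (rule weakly_harmonic_imp_L_harmonic[OF assms(1,2)])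
  have "{y. (x, y) \<in> {(x, y). x \<noteq> y}} = - {x}" by auto
  moreover have "open {(x, y). x \<noteq> (y :: real^'n)}"
    unfolding case_prod_beta by (intro open_Collect_neq continuous_intros)
  moreover have "smooth_on {(x, y). x \<noteq> y} (\<lambda>(x, y). \<Gamma> x y)" using assms(3) by (simp add: FS_def)
  ultimately show "smooth_on (- {x}) (\<Gamma> x)"
    using smooth_on_slice[of "{(x, y). x \<noteq> y}" "\<lambda>(x, y). \<Gamma> x y" x] by simp
next
  fix \<phi> assume \<phi>: "\<phi> \<in> test_functions (- {x})"
  then have "\<phi> x = 0" using closure_subset[of "{x. \<phi> x \<noteq> 0}"] by (auto simp: test_functions_def supp_def)
  moreover have "\<phi> \<in> test_functions UNIV" using \<phi> by (auto simp: test_functions_def)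
  ultimately show "(LINT y|lborel. \<Gamma> x y * L_op V A \<phi> y * V y) = 0"
    using assms(3) unfolding FS_def by (metis neg_0_equal_iff_equal)
qed auto

section \<open>Thin sets are \<open>p\<close>-bounded\<close>

text \<open>Away from \<open>x\<close> this is continuity of a positive function; at
  \<open>x\<close> the pole sends the reciprocal to zero, the value fixed in
  \<open>gam\<close>.\<close>

lemma gam_continuous:
  assumes FS: "FS V A \<Gamma>" and H: "H1 V A" "H2 A"
  shows "continuous_on UNIV (gam \<Gamma> x)"
proof (intro continuous_at_imp_continuous_on ballI)
  fix y
  have pos: "0 < \<Gamma> x z" if "x \<noteq> z" for z using FS that by (simp add: FS_def)
  show "isCont (gam \<Gamma> x) y"
  proof (cases "y = x")
    case False
    have "continuous_on (- {x}) (\<Gamma> x)"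
      using FS_L_harmonic[OF H FS] by (auto simp: L_harmonic_def intro: smooth_on_imp_continuous_on)
    then have "isCont (\<Gamma> x) y" using False continuous_on_eq_continuous_at[of "- {x}" "\<Gamma> x"] by auto
    then have "((\<lambda>z. 1 / \<Gamma> x z) \<longlongrightarrow> 1 / \<Gamma> x y) (at y)"
      using pos[of y] False by (intro tendsto_intros) (auto simp: isCont_def)
    then have "(gam \<Gamma> x \<longlongrightarrow> 1 / \<Gamma> x y) (at y)"
      by (rule Lim_transform_within_open[of _ _ _ UNIV "- {x}"]) (use False in \<open>auto simp: gam_def\<close>)
    then show ?thesis using False by (simp add: isCont_def gam_def)
  next
    case True
    have "filterlim (\<Gamma> x) at_top (at x)" using FS by (simp add: FS_def)
    then have "((\<lambda>z. inverse (\<Gamma> x z)) \<longlongrightarrow> 0) (at x)" by (rule tendsto_inverse_0_at_top)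
    then have "(gam \<Gamma> x \<longlongrightarrow> 0) (at x)"
      by (rule Lim_transform_within_open[of _ _ _ UNIV UNIV]) (auto simp: gam_def inverse_eq_divide)
    then show ?thesis using True by (simp add: isCont_def gam_def)
  qed
qed

lemma gam_at_infinity:
  assumes FS: "FS V A \<Gamma>"
  shows "filterlim (gam \<Gamma> x) at_top at_infinity"
proof -
  have ne: "\<forall>\<^sub>F z in at_infinity. x \<noteq> z"
    by (rule eventually_at_infinityI[of "norm x + 1"]) auto
  have "(\<Gamma> x \<longlongrightarrow> 0) at_infinity" using FS by (simp add: FS_def)
  moreover have "\<forall>\<^sub>F z in at_infinity. 0 < \<Gamma> x z"
    using ne by eventually_elim (use FS in \<open>simp add: FS_def\<close>)
  ultimately have "filterlim (\<lambda>z. inverse (\<Gamma> x z)) at_top at_infinity"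
    by (rule filterlim_inverse_at_top)
  then show ?thesis
    by (rule filterlim_cong[THEN iffD1, rotated 3, OF _ refl refl])
      (use ne in eventually_elim, simp add: gam_def inverse_eq_divide)
qed

lemma bounded_gam_le:
  assumes "FS V A \<Gamma>"
  shows "bounded {z. gam \<Gamma> x z \<le> r}"
proof -
  have "\<forall>\<^sub>F z in at_infinity. r < gam \<Gamma> x z"
    using gam_at_infinity[OF assms] by (auto simp: filterlim_at_top_dense)
  then obtain b where "\<And>z. b \<le> norm z \<Longrightarrow> r < gam \<Gamma> x z" by (auto simp: eventually_at_infinity)
  then show ?thesis by (intro boundedI[of _ b]) (force simp: not_less[symmetric])
qed

text \<open>The constant is \<open>1 / \<theta>\<close>. With \<open>r = gam \<Gamma> x y\<close>
  the point \<open>x\<close> lies just outside the ball of radius \<open>r\<close> around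
  \<open>y\<close>, so (G) forbids a \<open>z\<close> closer than \<open>\<theta> * r\<close> to
  both.\<close>

lemma quasi_ultrametric_gam:
  assumes FS: "FS V A \<Gamma>" and "G_cond \<Gamma>"
  obtains K where "quasi_ultrametric (gam \<Gamma>) K"
proof -
  obtain \<theta> where \<theta>: "0 < \<theta>" "\<theta> < 1" and disj: "\<And>x y r. 0 < r \<Longrightarrow> x \<notin> Gamma_ball \<Gamma> y r \<Longrightarrow>
      Gamma_ball \<Gamma> x (\<theta> * r) \<inter> Gamma_ball \<Gamma> y (\<theta> * r) = {}"
    using assms(2) unfolding G_cond_def by auto
  have pos: "0 < \<Gamma> x y" "\<Gamma> x y = \<Gamma> y x" if "x \<noteq> y" for x y using FS that by (auto simp: FS_def)
  have nonneg: "0 \<le> gam \<Gamma> x y" for x y using pos(1)[of x y] by (auto simp: gam_def less_imp_le)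
  have comm: "gam \<Gamma> x y = gam \<Gamma> y x" for x y using pos[of x y] by (simp add: gam_def)
  have "gam \<Gamma> x y \<le> 1 / \<theta> * max (gam \<Gamma> x z) (gam \<Gamma> z y)" for x y z
  proof (rule ccontr)
    let ?r = "gam \<Gamma> x y"
    assume "\<not> ?thesis"
    then have less: "max (gam \<Gamma> x z) (gam \<Gamma> z y) < \<theta> * ?r" using \<theta> by (simp add: field_simps not_le)
    then have "0 < \<theta> * ?r" using nonneg[of x z] by simp
    then have "0 < ?r" using \<theta> by (simp add: zero_less_mult_iff)
    then have "Gamma_ball \<Gamma> x (\<theta> * ?r) \<inter> Gamma_ball \<Gamma> y (\<theta> * ?r) = {}"
      by (intro disj) (auto simp: Gamma_ball_def comm[of y x])
    moreover have "z \<in> Gamma_ball \<Gamma> x (\<theta> * ?r) \<inter> Gamma_ball \<Gamma> y (\<theta> * ?r)"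
      using less by (auto simp: Gamma_ball_def comm[of y z])
    ultimately show False by blast
  qed
  then have "quasi_ultrametric (gam \<Gamma>) (1 / \<theta>)"
    using \<theta> nonneg comm by unfold_locales (auto simp: gam_def)
  then show ?thesis by (rule that)
qed

text \<open>The continuous function \<open>gam \<Gamma> x\<close> is positive off \<open>U\<close>,
  so it has a positive minimum on the compact part of the complement where it is at most 1; lower
  sublevel sets lie in \<open>U\<close>.\<close>

lemma gam_ball_subset_open:
  assumes FS: "FS V A \<Gamma>" and H: "H1 V A" "H2 A" and U: "open U" "x \<in> U"
  obtains \<rho> where "0 < \<rho>" "{z. gam \<Gamma> x z \<le> \<rho>} \<subseteq> U"
proof -
  note cont = gam_continuous[OF FS H, of x]
  define C where "C = {z. gam \<Gamma> x z \<le> 1} - U"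
  have "closed {z. gam \<Gamma> x z \<le> 1}" using cont by (intro closed_Collect_le) auto
  then have "compact C"
    unfolding C_def using U bounded_gam_le[OF FS] by (auto simp: compact_eq_bounded_closed bounded_diff)
  have pos: "0 < gam \<Gamma> x z" if "z \<notin> U" for z
    using that U FS by (auto simp: gam_def FS_def)
  show ?thesis
  proof (cases "C = {}")
    case True
    then show ?thesis using that[of 1] by (auto simp: C_def)
  next
    case False
    have "continuous_on C (gam \<Gamma> x)" using cont continuous_on_subset by blast
    then obtain w where w: "w \<in> C" "\<And>z. z \<in> C \<Longrightarrow> gam \<Gamma> x w \<le> gam \<Gamma> x z"
      using continuous_attains_inf[OF \<open>compact C\<close> False] by blast
    have "0 < gam \<Gamma> x w" using w(1) pos by (auto simp: C_def)
    moreover have "{z. gam \<Gamma> x z \<le> min 1 (gam \<Gamma> x w / 2)} \<subseteq> U"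
      using w(2) \<open>0 < gam \<Gamma> x w\<close> by (force simp: C_def)
    ultimately show ?thesis using that[of "min 1 (gam \<Gamma> x w / 2)"] by auto
  qed
qed

section \<open>Comparison of subharmonic functions with potentials\<close>

text \<open>Compare \<open>u\<close> with \<open>h\<close> in a large ball minus the small balls
  around the poles. On the sphere the potential is negligible and \<open>h\<close> is at least
  \<open>S\<close>; at a small ball \<open>u < a\<close>, while the potential lowers
  \<open>h\<close> by at most \<open>S - a\<close>. Then let \<open>\<epsilon>\<close> tend to
  zero.\<close>

lemma subharmonic_le_potential:
  fixes u :: "real^'n::finite \<Rightarrow> ereal" and y :: "nat \<Rightarrow> real^'n" and m \<rho> :: "nat \<Rightarrow> real"
  assumes H: "H1 V A" "H2 A" and FS: "FS V A \<Gamma>" and u: "L_subharmonic V A UNIV u"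
    and S: "\<And>x. u x \<le> ereal S" and a: "a < S" and C: "0 < C"
    and \<rho>: "\<And>i. i < n \<Longrightarrow> 0 < \<rho> i" and m: "\<And>i. i < n \<Longrightarrow> 0 \<le> m i"
    and ball: "\<And>i. i < n \<Longrightarrow> {z. gam \<Gamma> (y i) z \<le> \<rho> i} \<subseteq> {z. u z < ereal a}"
    and pot: "\<And>x. (\<And>i. i < n \<Longrightarrow> \<rho> i \<le> gam \<Gamma> (y i) x) \<Longrightarrow> (\<Sum>i<n. m i / gam \<Gamma> (y i) x) \<le> C"
    and x0: "\<not> u x0 < ereal a"
  shows "u x0 \<le> ereal (S - (S - a) / C * (\<Sum>i<n. m i / gam \<Gamma> (y i) x0))"
proof (rule ereal_le_epsilon2)
  fix \<epsilon> :: real assume \<epsilon>: "0 < \<epsilon>"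
  define \<kappa> where "\<kappa> = (S - a) / C"
  have \<kappa>: "0 < \<kappa>" "\<kappa> * C = S - a" using a C by (auto simp: \<kappa>_def)
  define P where "P x = (\<Sum>i<n. m i * \<Gamma> (y i) x)" for x
  have P: "P x = (\<Sum>i<n. m i / gam \<Gamma> (y i) x)" if "\<And>i. i < n \<Longrightarrow> y i \<noteq> x" for x
    using that by (simp add: P_def gam_def)
  have pos: "0 < \<Gamma> x z" if "x \<noteq> z" for x z using FS that unfolding FS_def by blast
  have P0: "0 \<le> P x" if "\<And>i. i < n \<Longrightarrow> y i \<noteq> x" for x
    unfolding P_def using that m pos by (intro sum_nonneg mult_nonneg_nonneg) (auto simp: less_imp_le)
  have off: "y i \<noteq> x" if "i < n" "\<rho> i \<le> gam \<Gamma> (y i) x" for i x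
    using that \<rho>[of i] by (auto simp: gam_def split: if_splits)
  have "((\<lambda>x. \<kappa> * P x) \<longlongrightarrow> \<kappa> * (\<Sum>i<n. m i * 0)) at_infinity"
    unfolding P_def using FS by (intro tendsto_intros) (auto simp: FS_def)
  then have "\<forall>\<^sub>F x in at_infinity. \<kappa> * P x < \<epsilon>" using \<epsilon> by (simp add: order_tendstoD(2))
  then obtain b where b: "\<And>x. b \<le> norm x \<Longrightarrow> \<kappa> * P x < \<epsilon>" by (auto simp: eventually_at_infinity)
  \<comment> \<open>The radius lies beyond \<open>b\<close>, where the potential costs less than
    \<open>\<epsilon>\<close>, and the \<open>1\<close> puts \<open>x0\<close> inside the open
    ball.\<close>
  define r where "r = max b (norm x0 + 1)"
  define Z where "Z = (\<Inter>i<n. {x. \<rho> i < gam \<Gamma> (y i) x})"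
  define W where "W = ball 0 r \<inter> Z"
  \<comment> \<open>The space without the poles: an open set around \<open>closure W\<close> on
    which \<open>h\<close> is harmonic, which also gives continuity up to the boundary.\<close>
  define U where "U = (\<Inter>i<n. - {y i})"
  define h where "h x = (S + \<epsilon>) + (- \<kappa>) * P x" for x
  have cont: "continuous_on UNIV (gam \<Gamma> x)" for x by (rule gam_continuous[OF FS H])
  have "open Z" unfolding Z_def using cont by (intro open_INT) (auto intro!: open_Collect_less)
  then have oW: "open W" unfolding W_def by auto
  have oU: "open U" unfolding U_def by (intro open_INT) auto
  have "closed {x. \<forall>i<n. \<rho> i \<le> gam \<Gamma> (y i) x}"
    using cont by (intro closed_Collect_all closed_Collect_imp open_Collect_const closed_Collect_le) auto
  then have cW: "closure W \<subseteq> {x. \<forall>i<n. \<rho> i \<le> gam \<Gamma> (y i) x}"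
    by (intro closure_minimal) (auto simp: W_def Z_def less_imp_le)
  then have WU: "closure W \<subseteq> U" using off by (auto simp: U_def)
  have "L_harmonic V A U (\<Gamma> (y i))" if "i < n" for i
    using that by (intro L_harmonic_subset[OF FS_L_harmonic[OF H FS]]) (auto simp: U_def)
  then have hU: "L_harmonic V A U h" unfolding h_def P_def
    by (intro L_harmonic_linear L_harmonic_const L_harmonic_sum H oU) auto
  have "\<forall>x\<in>W. u x \<le> ereal (h x)"
  proof -
    have "continuous_on (closure W) h"
      using hU continuous_on_subset[OF smooth_on_imp_continuous_on WU] by (simp add: L_harmonic_def)
    moreover have "L_harmonic V A W h" using hU WU closure_subset[of W] by (intro L_harmonic_subset[OF hU]) auto
    moreover have "u x \<le> ereal (h x)" if x: "x \<in> frontier W" for x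
    proof -
      have xW: "x \<in> closure W" "x \<notin> W" using x oW by (auto simp: frontier_def interior_open)
      then have ge: "\<rho> i \<le> gam \<Gamma> (y i) x" if "i < n" for i using cW that by blast
      have Px: "P x = (\<Sum>i<n. m i / gam \<Gamma> (y i) x)" using P off ge by blast
      show ?thesis
      proof (cases "x \<in> Z")
        case True
        then have "b \<le> norm x" using xW(2) by (auto simp: W_def r_def)
        then have "S \<le> h x" using b[of x] by (simp add: h_def)
        then show ?thesis using S[of x] by (meson ereal_less_eq(3) order_trans)
      next
        case False
        then obtain i where "i < n" "x \<in> {z. gam \<Gamma> (y i) z \<le> \<rho> i}" by (auto simp: Z_def not_less)
        then have "u x < ereal a" using ball by blast
        moreover have "\<kappa> * P x \<le> S - a"
          using mult_left_mono[OF pot[OF ge], of \<kappa>] \<kappa> by (simp add: Px)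
        ultimately show ?thesis using \<epsilon> by (auto simp: h_def intro: order_trans[OF less_imp_le])
      qed
    qed
    moreover have "bounded W" by (simp add: W_def bounded_Int)
    ultimately show ?thesis using u oW unfolding L_subharmonic_def by blast
  qed
  \<comment> \<open>The closed small balls lie where \<open>u < a\<close>, hence miss
    \<open>x0\<close>.\<close>
  moreover have x0W: "x0 \<in> W"
    using x0 ball by (force simp: W_def Z_def r_def not_less[symmetric])
  moreover have "P x0 = (\<Sum>i<n. m i / gam \<Gamma> (y i) x0)"
    using x0W \<rho> by (intro P) (force simp: W_def Z_def gam_def)
  ultimately have "u x0 \<le> ereal (S + \<epsilon> - \<kappa> * (\<Sum>i<n. m i / gam \<Gamma> (y i) x0))" by (auto simp: h_def)
  then show "u x0 \<le> ereal (S - (S - a) / C * (\<Sum>i<n. m i / gam \<Gamma> (y i) x0)) + ereal \<epsilon>"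
    by (simp add: \<kappa>_def algebra_simps)
qed

text \<open>One further \<Gamma>-ball swallows the bounded set \<open>B\<close>; it takes the index
  \<open>0\<close> and the given family is shifted by \<open>Suc\<close>. Its centre avoids the
  origin, where the term would be infinite, so it adds a finite term.\<close>

lemma p_boundedI:
  fixes S :: "nat set"
  assumes FS: "FS V A \<Gamma>" and H: "H1 V A" "H2 A" and b: "bounded B"
    and cover: "F \<subseteq> B \<union> (\<Union>j\<in>S. Gamma_ball \<Gamma> (y j) (r j))"
    and y: "\<And>j. j \<in> S \<Longrightarrow> y j \<noteq> (0 :: real^'n::finite)" and r: "\<And>j. j \<in> S \<Longrightarrow> 0 < r j"
    and sums: "\<And>S0. finite S0 \<Longrightarrow> S0 \<subseteq> S \<Longrightarrow> (\<Sum>j\<in>S0. (r j / gam \<Gamma> 0 (y j)) powr p) \<le> M"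
  shows "p_bounded \<Gamma> p F"
proof -
  obtain x1 :: "real^'n" where x1: "x1 \<noteq> 0" by (metis axis_eq_0_iff zero_neq_one)
  have "compact (closure B)" using b by (simp add: compact_closure)
  then have "bounded (gam \<Gamma> x1 ` closure B)"
    using continuous_on_subset[OF gam_continuous[OF FS H]]
    by (intro compact_imp_bounded compact_continuous_image) auto
  then obtain t where t: "\<And>z. z \<in> closure B \<Longrightarrow> \<bar>gam \<Gamma> x1 z\<bar> \<le> t" by (auto simp: bounded_iff)
  define r1 where "r1 = \<bar>t\<bar> + 1"
  have B: "B \<subseteq> Gamma_ball \<Gamma> x1 r1"
    using t closure_subset[of B] by (fastforce simp: Gamma_ball_def r1_def)
  define J where "J = insert 0 (Suc ` S)"
  define x where "x = case_nat x1 y"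
  define q where "q = case_nat r1 r"
  define f where "f n = (if x n = 0 then \<infinity> else ennreal ((q n / gam \<Gamma> 0 (x n)) powr p))" for n
  have "sum f G \<le> f 0 + ennreal M" if G: "finite G" "G \<subseteq> J" for G
  proof -
    define G' where "G' = {k. Suc k \<in> G}"
    have G': "finite G'" "G' \<subseteq> S"
      using G finite_vimageI[of G Suc] by (auto simp: G'_def J_def vimage_def)
    have "G \<subseteq> insert 0 (Suc ` G')"
    proof
      fix k assume "k \<in> G"
      then show "k \<in> insert 0 (Suc ` G')" by (cases k) (auto simp: G'_def)
    qed
    then have "sum f G \<le> sum f (insert 0 (Suc ` G'))" using G' by (intro sum_mono2) auto
    also have "\<dots> = f 0 + (\<Sum>k\<in>G'. f (Suc k))" using G' by (simp add: sum.reindex)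
    also have "(\<Sum>k\<in>G'. f (Suc k)) = (\<Sum>k\<in>G'. ennreal ((r k / gam \<Gamma> 0 (y k)) powr p))"
      using G' y by (intro sum.cong) (auto simp: f_def x_def q_def)
    also have "\<dots> = ennreal (\<Sum>k\<in>G'. (r k / gam \<Gamma> 0 (y k)) powr p)" by (intro sum_ennreal) auto
    also have "\<dots> \<le> ennreal M" using sums[OF G'] by (rule ennreal_leI)
    finally show ?thesis by (simp add: add_left_mono)
  qed
  \<comment> \<open>In \<open>ennreal\<close> the sum is the supremum of its finite partial
    sums.\<close>
  then have "infsum f J \<le> f 0 + ennreal M"
    by (subst nonneg_infsum_complete) (auto intro!: SUP_least)
  also have "\<dots> < \<infinity>" using x1 by (simp add: f_def x_def)
  finally have "infsum f J < \<infinity>" .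
  moreover have "F \<subseteq> (\<Union>n\<in>J. Gamma_ball \<Gamma> (x n) (q n))"
    using cover B by (auto simp: J_def x_def q_def)
  moreover have "\<forall>n\<in>J. 0 < q n" using r by (auto simp: J_def q_def r1_def)
  ultimately show ?thesis unfolding p_bounded_def f_def by blast
qed

lemma countable_subcover:
  fixes B :: "'i \<Rightarrow> 'a::second_countable_topology set"
  assumes "\<And>z. z \<in> E \<Longrightarrow> open (B z)"
  shows "\<exists>Y\<subseteq>E. countable Y \<and> (\<Union>z\<in>E. B z) \<subseteq> (\<Union>z\<in>Y. B z)"
proof -
  have op: "open S" if "S \<in> B ` E" for S using that assms by auto
  obtain F where F: "F \<subseteq> B ` E" "countable F" "\<Union>F = \<Union>(B ` E)"
    by (rule Lindelof[OF op])
  obtain Y where "Y \<subseteq> E" "countable Y" "F = B ` Y"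
    using F(1,2) countable_subset_image[of F B E] by auto
  then show ?thesis using F(3) by (intro exI[of _ Y]) auto
qed

text \<open>The comparison at a point \<open>x0\<close> where \<open>u\<close> nearly attains
  \<open>S\<close> gives an inequality for the sum \<open>Q\<close> of \<open>m i / R i\<close> in
  which \<open>Q\<close> recurs on the right with a small factor. Absorbing that term bounds
  \<open>Q\<close> uniformly in the number of centres, and the Vitali cover then has a finite
  sum.\<close>

lemma thin_imp_p_bounded:
  fixes V :: "real^'n::finite \<Rightarrow> real"
  assumes H: "H1 V A" "H2 A" and FS: "FS V A \<Gamma>" and G: "G_cond \<Gamma>" and p: "1 < p"
    and u: "L_subharmonic V A UNIV u" and S: "\<And>x. u x \<le> ereal S" and S': "\<And>t. t < S \<Longrightarrow> \<exists>x. ereal t < u x"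
    and a: "a < S" and B: "bounded B" and F: "F \<subseteq> B \<union> {z. u z < ereal a}"
  shows "p_bounded \<Gamma> p F"
proof -
  let ?d = "gam \<Gamma>"
  obtain K where "quasi_ultrametric ?d K" using quasi_ultrametric_gam[OF FS G] .
  then interpret quasi_ultrametric ?d K .
  have K: "0 < K" "1 \<le> K" using K_ge_1 by auto
  define c where "c = 1 / (2 * K)"
  define e where "e = c / K ^ 3"
  \<comment> \<open>The part of the bound in \<open>potential_bound\<close> that does not depend on
    the masses.\<close>
  define C1 where "C1 = 2 * (K * (K ^ 2) powr p) / (1 - 2 powr (1 - p)) * (e * K) powr (p - 1)"
  have c: "0 < c" using K by (simp add: c_def)
  have e: "0 < e" using K c by (simp add: e_def)
  have "2 powr (1 - p) < (1::real)" using p by (simp add: powr_less_one)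
  then have C1: "0 < C1" using K e by (simp add: C1_def)
  \<comment> \<open>\<open>\<delta> * K / e \<le> 1 / 2\<close> allows the absorption of
    \<open>Q\<close>, and \<open>\<delta> < 1\<close> keeps \<open>u x0\<close> above
    \<open>a\<close>.\<close>
  define \<delta> where "\<delta> = min (1/2) (e / (2 * K))"
  have \<delta>: "0 < \<delta>" "\<delta> < 1" "\<delta> * K / e \<le> 1 / 2"
    using e K by (auto simp: \<delta>_def min_def field_simps)
  have "S - (S - a) * \<delta> < S" using a \<delta> by simp
  then obtain x0 where x0: "ereal (S - (S - a) * \<delta>) < u x0" using S' by blast
  have "a < S - (S - a) * \<delta>"
  proof -
    have "(S - a) * \<delta> < (S - a) * 1" using a \<delta> by (intro mult_strict_left_mono) auto
    then show ?thesis by simp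
  qed
  then have x0a: "\<not> u x0 < ereal a" using x0 by (metis ereal_less_eq(3) less_imp_le not_less order_trans less_le_trans)
  have cont: "continuous_on UNIV (?d x)" for x by (rule gam_continuous[OF FS H])
  have "openin (top_of_set UNIV) {x \<in> UNIV. u x < ereal a}"
    using u unfolding L_subharmonic_def usc_on_def by blast
  then have "open {x. u x < ereal a}" by simp
  \<comment> \<open>Only points farther from the origin than \<open>x0\<close> become centres, so
    that \<open>R i > 0\<close> and \<open>?d (y i) x0 \<le> K * R i\<close>; the rest is bounded
    and left to a single ball.\<close>
  define E where "E = {x. u x < ereal a} \<inter> {x. ?d 0 x0 < ?d 0 x}"
  have "open E" unfolding E_def using cont
    by (intro open_Int \<open>open {x. u x < ereal a}\<close>) (auto intro: open_Collect_less)
  have EF: "F \<subseteq> (B \<union> {z. ?d 0 z \<le> ?d 0 x0}) \<union> E" using F by (auto simp: E_def)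
  have bdd: "bounded (B \<union> {z. ?d 0 z \<le> ?d 0 x0})" using B bounded_gam_le[OF FS] by simp
  show ?thesis
  proof (cases "E = {}")
    case True
    show ?thesis by (rule p_boundedI[OF FS H bdd, where S = "{}" and M = 0]) (use EF True in auto)
  next
    case False
    \<comment> \<open>The cap \<open>c * ?d 0 z\<close> keeps the interval of admissible radii
      nonempty.\<close>
    have "\<exists>\<rho>. 0 < \<rho> \<and> \<rho> \<le> c * ?d 0 z \<and> {w. ?d z w \<le> \<rho>} \<subseteq> {x. u x < ereal a}" if "z \<in> E" for z
    proof -
      have "z \<in> {x. u x < ereal a}" using that by (simp add: E_def)
      then obtain \<rho> where \<rho>: "0 < \<rho>" "{w. ?d z w \<le> \<rho>} \<subseteq> {x. u x < ereal a}"
        using gam_ball_subset_open[OF FS H \<open>open {x. u x < ereal a}\<close>] by blast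
      have "0 < c * ?d 0 z" using that c d_nonneg[of 0 x0] by (auto simp: E_def)
      then show ?thesis using \<rho> by (intro exI[of _ "min \<rho> (c * ?d 0 z)"]) auto
    qed
    then obtain rad where rad: "\<And>z. z \<in> E \<Longrightarrow> 0 < rad z" "\<And>z. z \<in> E \<Longrightarrow> rad z \<le> c * ?d 0 z"
      "\<And>z. z \<in> E \<Longrightarrow> {w. ?d z w \<le> rad z} \<subseteq> {x. u x < ereal a}" by metis
    have "open (Gamma_ball \<Gamma> z r)" for z r
      unfolding Gamma_ball_def using cont by (intro open_Collect_less) auto
    then obtain Y where Y: "countable Y" "Y \<subseteq> E"
        "(\<Union>z\<in>E. Gamma_ball \<Gamma> z (rad z)) \<subseteq> (\<Union>z\<in>Y. Gamma_ball \<Gamma> z (rad z))"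
      using countable_subcover[of E "\<lambda>z. Gamma_ball \<Gamma> z (rad z)"] by auto
    have self: "z \<in> Gamma_ball \<Gamma> z (rad z)" if "z \<in> E" for z
      using rad(1)[OF that] by (simp add: Gamma_ball_def d_self)
    then have EY: "E \<subseteq> (\<Union>z\<in>Y. Gamma_ball \<Gamma> z (rad z))" using Y(3) by blast
    then have "Y \<noteq> {}" using False by auto
    \<comment> \<open>If \<open>Y\<close> is finite the enumeration repeats centres; the constraints
      then count the masses of all copies.\<close>
    define y where "y = from_nat_into Y"
    have rangeY: "range y = Y" using Y(1) \<open>Y \<noteq> {}\<close> by (simp add: y_def)
    then have yE: "y i \<in> E" for i using Y(2) by blast
    define \<rho> where "\<rho> i = rad (y i)" for i
    define R where "R i = ?d 0 (y i)" for i
    have \<rho>: "0 < \<rho> i" "\<rho> i \<le> c * R i" "{w. ?d (y i) w \<le> \<rho> i} \<subseteq> {x. u x < ereal a}" for i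
      using rad[OF yE[of i]] by (auto simp: \<rho>_def R_def)
    have R: "0 < R i" "?d 0 x0 \<le> R i" for i
      using yE[of i] d_nonneg[of 0 x0] by (auto simp: R_def E_def)
    have "\<exists>m. \<forall>n. 0 \<le> m n \<and> (\<forall>t\<in>{\<rho> n..c * R n}. 0 < m n \<longrightarrow>
         m n + sum m {k. k < n \<and> ?d (y n) (y k) < t} \<le> R n * (t / R n) powr p) \<and>
       (\<exists>t\<in>{\<rho> n..c * R n}.
         R n * (t / R n) powr p / 2 \<le> m n + sum m {k. k < n \<and> ?d (y n) (y k) < t})"
    \<comment> \<open>The budget increases with the radius, so its value at the smallest radius
      \<open>\<rho> n\<close> is the required positive lower bound.\<close>
    proof (rule greedy_masses)
      show "0 < R n * (\<rho> n / R n) powr p" for n using R(1)[of n] \<rho>(1)[of n] by simp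
      show "R n * (\<rho> n / R n) powr p \<le> R n * (t / R n) powr p" if "t \<in> {\<rho> n..c * R n}" for n t
        using that R(1)[of n] \<rho>(1)[of n] p
        by (intro mult_left_mono powr_mono2 divide_right_mono) auto
    qed (use \<rho> in auto)
    then obtain m where m: "\<And>n. 0 \<le> m n"
      "\<And>n t. \<rho> n \<le> t \<Longrightarrow> t \<le> c * R n \<Longrightarrow> 0 < m n \<Longrightarrow>
         m n + sum m {k. k < n \<and> ?d (y n) (y k) < t} \<le> R n * (t / R n) powr p"
      "\<And>n. \<exists>t\<in>{\<rho> n..c * R n}.
         R n * (t / R n) powr p / 2 \<le> m n + sum m {k. k < n \<and> ?d (y n) (y k) < t}"
      by (auto simp only: atLeastAtMost_iff Ball_def)
    have "\<exists>t. \<forall>n. t n \<in> {\<rho> n..c * R n} \<and>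
        R n * (t n / R n) powr p / 2 \<le> m n + sum m {k. k < n \<and> ?d (y n) (y k) < t n}"
      by (rule choice, rule allI, rule m(3)[unfolded Bex_def])
    then obtain t where t: "\<And>n. \<rho> n \<le> t n" "\<And>n. t n \<le> c * R n"
      "\<And>n. R n * (t n / R n) powr p / 2 \<le> m n + sum m {k. k < n \<and> ?d (y n) (y k) < t n}"
      by (auto simp only: atLeastAtMost_iff)
    have Q: "(\<Sum>i<n. m i / ?d 0 (y i)) \<le> K * C1" for n
    proof -
      define Q where "Q = (\<Sum>i<n. m i / R i)"
      have Q0: "0 \<le> Q" using m(1) R(1) by (auto simp: Q_def intro!: sum_nonneg divide_nonneg_pos)
      have C: "0 < C1 + Q / e" using C1 Q0 e by (simp add: add_pos_nonneg)
      have pot: "(\<Sum>i<n. m i / ?d (y i) x) \<le> C1 + Q / e" if x: "\<And>i. i < n \<Longrightarrow> \<rho> i \<le> ?d (y i) x" for x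
      proof -
        have "(\<Sum>i<n. m i / ?d x (y i)) \<le> C1 + Q / e"
          unfolding C1_def e_def c_def Q_def R_def
        proof (rule potential_bound[OF p, where \<rho> = \<rho>])
          fix i
          show "0 < ?d 0 (y i)" using R(1) by (simp add: R_def)
          show "0 < \<rho> i" "0 \<le> m i" using \<rho> m by auto
          show "m i + sum m {k. k < i \<and> ?d (y i) (y k) < t} \<le> ?d 0 (y i) * (t / ?d 0 (y i)) powr p"
            if "\<rho> i \<le> t" "t \<le> 1 / (2 * K) * ?d 0 (y i)" "0 < m i" for t
            using m(2)[of i t] that by (simp add: R_def c_def)
          show "\<rho> i \<le> ?d x (y i)" if "i < n" using x[OF that] by (simp add: d_commute[of x])
        qed
        then show ?thesis by (simp add: d_commute[of x])
      qed
      define P where "P = (\<Sum>i<n. m i / ?d (y i) x0)"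
      have "u x0 \<le> ereal (S - (S - a) / (C1 + Q / e) * P)"
        unfolding P_def
        by (rule subharmonic_le_potential[OF H FS u S a C, where \<rho> = \<rho>]) (use \<rho> m pot x0a in auto)
      then have "ereal (S - (S - a) * \<delta>) < ereal (S - (S - a) / (C1 + Q / e) * P)"
        by (rule less_le_trans[OF x0])
      then have "(S - a) * (P / (C1 + Q / e)) < (S - a) * \<delta>" by simp
      then have "P / (C1 + Q / e) < \<delta>"
        using a by (simp only: mult_less_cancel_left_pos diff_gt_0_iff_gt)
      then have P: "P < \<delta> * (C1 + Q / e)" using C by (simp add: field_simps)
      have "Q / K \<le> P" unfolding Q_def P_def sum_divide_distrib
      proof (rule sum_mono)
        fix i
        have "\<rho> i < ?d (y i) x0" using \<rho>(3)[of i] x0a by (auto simp: not_less[symmetric])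
        then have pos: "0 < ?d (y i) x0" using \<rho>(1)[of i] by linarith
        have "?d (y i) x0 \<le> K * max (?d (y i) 0) (?d 0 x0)" by (rule d_triangle)
        also have "\<dots> \<le> K * R i" using R(2)[of i] K by (intro mult_left_mono) (auto simp: R_def d_commute)
        finally have "m i / (K * R i) \<le> m i / ?d (y i) x0"
          using m(1) pos R(1)[of i] K by (intro divide_left_mono) auto
        then show "m i / R i / K \<le> m i / ?d (y i) x0" by (simp add: mult.commute)
      qed
      with P have "Q / K < \<delta> * (C1 + Q / e)" by linarith
      then have "Q < K * (\<delta> * (C1 + Q / e))" using K by (simp add: field_simps)
      also have "\<dots> = K * \<delta> * C1 + (\<delta> * K / e) * Q" by (simp add: field_simps)
      \<comment> \<open>Half of \<open>Q\<close> remains on the left, which gives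
        \<open>Q < K * C1\<close>.\<close>
      also have "\<dots> \<le> K * (1 / 2) * C1 + 1 / 2 * Q"
        using \<delta> K C1 Q0 by (intro add_mono mult_right_mono mult_left_mono) (auto simp: \<delta>_def)
      finally show ?thesis by (simp add: Q_def R_def)
    qed
    have tpos: "0 < t i" for i using t(1)[of i] \<rho>(1)[of i] by linarith
    have "\<exists>J. (\<Union>i. {z. ?d (y i) z < t i}) \<subseteq> (\<Union>j\<in>J. {z. ?d (y j) z < 2 * K ^ 4 * t j}) \<and>
      (\<forall>J0. finite J0 \<and> J0 \<subseteq> J \<longrightarrow> (\<Sum>j\<in>J0. (t j / ?d 0 (y j)) powr p) \<le> 2 * K * (K * C1))"
      using R(1) tpos t(2,3) m(1) Q unfolding R_def c_def by (intro greedy_cover[OF p, where m = m])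
    then obtain J where J: "(\<Union>i. {z. ?d (y i) z < t i}) \<subseteq> (\<Union>j\<in>J. {z. ?d (y j) z < 2 * K ^ 4 * t j})"
      "\<And>J0. finite J0 \<Longrightarrow> J0 \<subseteq> J \<Longrightarrow> (\<Sum>j\<in>J0. (t j / ?d 0 (y j)) powr p) \<le> 2 * K * (K * C1)"
      by auto
    show ?thesis
    proof (rule p_boundedI[OF FS H bdd, where S = J and y = y and r = "\<lambda>j. 2 * K ^ 4 * t j"
          and M = "(2 * K ^ 4) powr p * (2 * K * (K * C1))"])
      \<comment> \<open>Each saturated radius \<open>t i\<close> is at least
        \<open>\<rho> i\<close>, so the larger balls still cover \<open>E\<close>.\<close>
      have "E \<subseteq> (\<Union>i. {z. ?d (y i) z < t i})"
      proof
        fix z assume "z \<in> E"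
        then obtain i where "z \<in> Gamma_ball \<Gamma> (y i) (rad (y i))" using EY rangeY by blast
        then have "?d (y i) z < t i" using t(1)[of i] by (simp add: Gamma_ball_def \<rho>_def)
        then show "z \<in> (\<Union>i. {z. ?d (y i) z < t i})" by blast
      qed
      also note J(1)
      finally have "E \<subseteq> (\<Union>j\<in>J. Gamma_ball \<Gamma> (y j) (2 * K ^ 4 * t j))" by (simp add: Gamma_ball_def)
      then show "F \<subseteq> (B \<union> {z. ?d 0 z \<le> ?d 0 x0}) \<union> (\<Union>j\<in>J. Gamma_ball \<Gamma> (y j) (2 * K ^ 4 * t j))"
        using EF by blast
      show "y j \<noteq> 0" for j using R(1)[of j] by (auto simp: R_def d_self)
      show "0 < 2 * K ^ 4 * t j" for j using K tpos by simp
      fix J0 assume J0: "finite J0" "J0 \<subseteq> J"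
      have "(2 * K ^ 4 * t j / ?d 0 (y j)) powr p = (2 * K ^ 4) powr p * (t j / ?d 0 (y j)) powr p" for j
        using K tpos[of j] R(1)[of j] by (simp add: powr_mult[symmetric] R_def)
      then have "(\<Sum>j\<in>J0. (2 * K ^ 4 * t j / ?d 0 (y j)) powr p)
          = (2 * K ^ 4) powr p * (\<Sum>j\<in>J0. (t j / ?d 0 (y j)) powr p)"
        by (simp add: sum_distrib_left)
      also have "\<dots> \<le> (2 * K ^ 4) powr p * (2 * K * (K * C1))"
        using J(2)[OF J0] by (intro mult_left_mono) auto
      finally show "(\<Sum>j\<in>J0. (2 * K ^ 4 * t j / ?d 0 (y j)) powr p) \<le> (2 * K ^ 4) powr p * (2 * K * (K * C1))" .
    qed
  qed
qed

section \<open>Largeness of p-unbounded sets\<close>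

theorem theorem1p5:
  fixes V :: "real^'n::finite \<Rightarrow> real"
    and A :: "real^'n \<Rightarrow> real^'n^'n"
    and \<Gamma> :: "real^'n \<Rightarrow> real^'n \<Rightarrow> real"
    and F :: "(real^'n) set"
  assumes "H1 V A"
    and "H2 A"
    and "H3 V A"
    and "FS V A \<Gamma>"
    and "G_cond \<Gamma>"
    and "L_cond V A"
    and "F \<noteq> {}"
    and "\<exists>p>1. p_unbounded \<Gamma> p F"
  shows "large_at_infinity V A F"
  unfolding large_at_infinity_def
proof
  assume thin: "thin_at_infinity V A F"
  obtain p where p: "1 < p" "\<not> p_bounded \<Gamma> p F" using assms(8) by (auto simp: p_unbounded_def)
  \<comment> \<open>A bounded set fits into one \<Gamma>-ball, so thinness of \<open>F\<close> is
    the condition on limits superior.\<close>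
  have "\<not> bounded F"
    using p_boundedI[OF assms(4,1,2), where B = F and F = F and S = "{}" and M = 0] p(2) by auto
  then obtain u where u: "u \<in> L_subharmonic_b V A UNIV"
      "Limsup (inf at_infinity (principal F)) u < Limsup at_infinity u"
    using thin by (auto simp: thin_at_infinity_def)
  then obtain M where sub: "L_subharmonic V A UNIV u" and M: "\<And>x. u x \<le> ereal M"
    by (auto simp: L_subharmonic_b_def)
  obtain a where a: "Limsup (inf at_infinity (principal F)) u < ereal a" "ereal a < Limsup at_infinity u"
    using ereal_dense2[OF u(2)] by blast
  \<comment> \<open>The global supremum \<open>S\<close> replaces the limit superior at infinity: it
    lies above \<open>a\<close>, and the upper bound \<open>M\<close> makes it finite.\<close>
  have "Limsup at_infinity u \<le> (SUP x. u x)"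
    by (intro Limsup_bounded always_eventually allI SUP_upper UNIV_I)
  then have aS: "ereal a < (SUP x. u x)" using a(2) by (rule less_le_trans[rotated])
  moreover have "(SUP x. u x) \<le> ereal M" using M by (rule SUP_least)
  ultimately obtain S where S: "(SUP x. u x) = ereal S"
    by (cases "SUP x. u x") auto
  have "\<forall>\<^sub>F x in inf at_infinity (principal F). u x < ereal a" using a(1) by (rule Limsup_lessD)
  then have "\<forall>\<^sub>F x in at_infinity. x \<in> F \<longrightarrow> u x < ereal a" by (simp add: eventually_inf_principal)
  then obtain b where b: "\<And>x. b \<le> norm x \<Longrightarrow> x \<in> F \<Longrightarrow> u x < ereal a"
    by (auto simp: eventually_at_infinity)
  have "p_bounded \<Gamma> p F"
  proof (rule thin_imp_p_bounded[OF assms(1,2,4,5) p(1) sub, of S a "ball 0 b"])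
    show "u x \<le> ereal S" for x unfolding S[symmetric] by (rule SUP_upper) simp
    show "\<exists>x. ereal t < u x" if "t < S" for t
      using that less_SUP_iff[of "ereal t" u UNIV] by (simp add: S)
    show "a < S" using aS by (simp add: S)
    show "F \<subseteq> ball 0 b \<union> {z. u z < ereal a}" using b by (auto simp: not_less)
  qed simp
  then show False using p(2) by simp
qed

end
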